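(* Let $(M,\bar F)$ be a two-dimensional cubic pseudo-Finsler space, with local coordinates, the domain $M_-$, the directions $p_1,p_2$, the curves $S_1,S_2\subset M_-$ and $\bar S_1,\bar S_2\subset PTM$ as defined in the context. Let $q\in M_-$ and $(q;p_i)\notin \bar S_i$, where $i\in\{1,2\}$. Then there exists a unique geodesic passing through the point $q$ with tangential direction $p_i$: a semicubic parabola with the cusp at $q$. In particular, if $q\in M_-\setminus(S_1\cup S_2)$, then the family $\Gamma_q$ of geodesics outgoing from $q$ contains two semicubic parabolas, with tangential directions $p_1$ and $p_2$, while geodesics with all remaining directions at $q$ are smooth.
   Context: Smooth means $C^\infty$. $M$ is a smooth 2-manifold with local coordinates $(x,y)$, and $\bar F(x,y;\dot x,\dot y)=\sum_{i=0}^{3}a_i(x,y)\dot x^{3-i}\dot y^{i}$ with smooth coefficients $a_i$; the metric function is $\bar F^{1/3}$ (cubic pseudo-Finsler metric). Put $F(x,y;p)=\sum_{i=0}^3 a_i(x,y)p^i$. $PTM$ is the projectivized tangent bundle with coordinates $(x,y;p)$, where $p=dy/dx\in\mathbb R P^1=\mathbb R\cup\{\infty\}$ is a tangent direction (near $p=\infty$ one uses the other affine chart, exchanging $x$ and $y$). Directions with $F=0$ are called isotropic, and curves all of whose tangent directions are isotropic are called isotropic lines. Let $D_{[F]}$ be the discriminant of the cubic polynomial $F$ in $p$. $M_\pm=\{\pm D_{[F]}>0\}$, $M_0=\{D_{[F]}=0\}$, $M_{0,0}\subset M_0$ is the set of points where $F$ has a triple root, and $M_{0,1}=M_0\setminus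 M_{0,0}$. Near any point of $M\setminus M_{0,0}$ the cubic $F$ has a simple real root depending smoothly on $(x,y)$, and one uses local coordinates in which the corresponding family of isotropic lines is $x=\mathrm{const}$; then $a_3\equiv 0$ and $F=ap^2+2bp+c$ with smooth $a,b,c$, $D_{[F]}=4a^2(b^2-ac)$, and $M_-=\{ac-b^2>0,\ a\ne0\}$. Let $\Delta=3FF_{pp}-2F_p^2=-2(ap+b)^2+6(ac-b^2)$ and $P=3F(F_y-F_{xp}-pF_{yp})+2F_p(F_x+pF_y)$, and consider on $PTM$ the vector field $V=\Delta(\partial_x+p\,\partial_y)+P\,\partial_p$. Geodesics (non-parametrized) are the projections to $M$, distinct from a point, of integral curves of $V$; the geodesic passes through $q$ with tangential direction $p$ if the integral curve passes through $(q;p)$. On $M_-$ the equation $\Delta=0$ has two simple real roots $p_{1,2}=\frac{\pm\delta-b}{a}$, $\delta=\sqrt{3(ac-b^2)}$. For $i=1,2$, $S_i=\{(x,y)\in M_-: P(x,y;p_i(x,y))=0\}$ and $\bar S_i=\{(x,y;p_i(x,y)):(x,y)\in S_i\}$. A semicubic parabola with the cusp at $q$ is a curve which, near $q$, is mapped to $\{Y^2=X^3\}$ by a local diffeomorphism sending $q$ to the origin. *)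

theory Defs
  imports "HOL-Analysis.Analysis"
begin

text \<open>On an open set \<open>S\<close> of a Euclidean space, \<open>Ck_on k S f\<close> says that \<open>f\<close> is of class
  \<open>C^k\<close>: all iterated directional derivatives up to order \<open>k\<close> exist and are continuous.\<close>

primrec Ck_on :: "nat \<Rightarrow> 'a::euclidean_space set \<Rightarrow> ('a \<Rightarrow> 'b::real_normed_vector) \<Rightarrow> bool" where
  "Ck_on 0 S f = continuous_on S f"
| "Ck_on (Suc k) S f =
     ((\<forall>z\<in>S. f differentiable (at z)) \<and> (\<forall>v. Ck_on k S (\<lambda>z. frechet_derivative f (at z) v)))"

definition smooth_on :: "'a::euclidean_space set \<Rightarrow> ('a \<Rightarrow> 'b::real_normed_vector) \<Rightarrow> bool" where
  "smooth_on S f \<longleftrightarrow> (\<forall>k. Ck_on k S f)"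

definition diffeo_on ::
  "'a::euclidean_space set \<Rightarrow> ('a \<Rightarrow> 'b::euclidean_space) \<Rightarrow> bool" where
  "diffeo_on N \<Phi> \<longleftrightarrow> open N \<and> open (\<Phi> ` N) \<and> inj_on \<Phi> N \<and>
     smooth_on N \<Phi> \<and> smooth_on (\<Phi> ` N) (inv_into N \<Phi>)"


section \<open>Cubic metrics in a coordinate domain\<close>

text \<open>A cubic form is given by its coefficients \<open>a i\<close>, \<open>i \<le> 3\<close>; the values \<open>a i\<close> for
  \<open>i > 3\<close> are irrelevant.  The metric function is the cube root of \<open>cubic_form a z w\<close>.\<close>

type_synonym coeffs = "nat \<Rightarrow> real \<times> real \<Rightarrow> real"

definition cubic_form :: "coeffs \<Rightarrow> real \<times> real \<Rightarrow> real \<times> real \<Rightarrow> real" where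
  "cubic_form a z w = (\<Sum>i\<le>3. a i z * fst w ^ (3 - i) * snd w ^ i)"

definition cubic_poly :: "coeffs \<Rightarrow> real \<Rightarrow> real \<Rightarrow> real \<Rightarrow> real" where
  "cubic_poly a x y p = (\<Sum>i\<le>3. a i (x, y) * p ^ i)"

definition F_x :: "coeffs \<Rightarrow> real \<Rightarrow> real \<Rightarrow> real \<Rightarrow> real" where
  "F_x a x y p = deriv (\<lambda>s. cubic_poly a s y p) x"

definition F_y :: "coeffs \<Rightarrow> real \<Rightarrow> real \<Rightarrow> real \<Rightarrow> real" where
  "F_y a x y p = deriv (\<lambda>s. cubic_poly a x s p) y"

definition F_p :: "coeffs \<Rightarrow> real \<Rightarrow> real \<Rightarrow> real \<Rightarrow> real" where
  "F_p a x y p = deriv (\<lambda>s. cubic_poly a x y s) p"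

definition F_xp :: "coeffs \<Rightarrow> real \<Rightarrow> real \<Rightarrow> real \<Rightarrow> real" where
  "F_xp a x y p = deriv (\<lambda>s. F_x a x y s) p"

definition F_yp :: "coeffs \<Rightarrow> real \<Rightarrow> real \<Rightarrow> real \<Rightarrow> real" where
  "F_yp a x y p = deriv (\<lambda>s. F_y a x y s) p"

definition F_pp :: "coeffs \<Rightarrow> real \<Rightarrow> real \<Rightarrow> real \<Rightarrow> real" where
  "F_pp a x y p = deriv (\<lambda>s. F_p a x y s) p"

text \<open>The discriminant of the cubic polynomial \<open>\<Sum>i\<le>3. a i z * p ^ i\<close> in \<open>p\<close>.\<close>

definition discr :: "coeffs \<Rightarrow> real \<times> real \<Rightarrow> real" where
  "discr a z = (a 2 z)\<^sup>2 * (a 1 z)\<^sup>2 - 4 * a 3 z * (a 1 z) ^ 3 - 4 * (a 2 z) ^ 3 * a 0 z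
     - 27 * (a 3 z)\<^sup>2 * (a 0 z)\<^sup>2 + 18 * a 3 z * a 2 z * a 1 z * a 0 z"

definition M_minus :: "(real \<times> real) set \<Rightarrow> coeffs \<Rightarrow> (real \<times> real) set" where
  "M_minus U a = {z \<in> U. discr a z < 0}"


section \<open>The vector field and its integral curves\<close>

definition Delta :: "coeffs \<Rightarrow> real \<Rightarrow> real \<Rightarrow> real \<Rightarrow> real" where
  "Delta a x y p = 3 * cubic_poly a x y p * F_pp a x y p - 2 * (F_p a x y p)\<^sup>2"

definition P_fun :: "coeffs \<Rightarrow> real \<Rightarrow> real \<Rightarrow> real \<Rightarrow> real" where
  "P_fun a x y p = 3 * cubic_poly a x y p * (F_y a x y p - F_xp a x y p - p * F_yp a x y p)
     + 2 * F_p a x y p * (F_x a x y p + p * F_y a x y p)"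

definition V_field :: "coeffs \<Rightarrow> (real \<times> real) \<times> real \<Rightarrow> (real \<times> real) \<times> real" where
  "V_field a = (\<lambda>((x, y), p). ((Delta a x y p, p * Delta a x y p), P_fun a x y p))"

definition integral_curve ::
  "'a::real_normed_vector set \<Rightarrow> ('a \<Rightarrow> 'a) \<Rightarrow> real set \<Rightarrow> (real \<Rightarrow> 'a) \<Rightarrow> bool" where
  "integral_curve W X J \<sigma> \<longleftrightarrow> open J \<and> is_interval J \<and>
     (\<forall>t\<in>J. \<sigma> t \<in> W \<and> (\<sigma> has_vector_derivative X (\<sigma> t)) (at t))"

text \<open>The second affine chart of the projectivized tangent bundle is obtained by exchanging
  the coordinates: there the cubic form has the coefficients \<open>swap_coeffs a\<close>, the fibre
  coordinate is \<open>dx/dy\<close>, and the vector field is \<open>V_field (swap_coeffs a)\<close>.\<close>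

definition swap_coeffs :: "coeffs \<Rightarrow> coeffs" where
  "swap_coeffs a i z = a (3 - i) (prod.swap z)"

lemma cubic_form_affine: "cubic_form a (x, y) (1, p) = cubic_poly a x y p"
  by (simp add: cubic_form_def cubic_poly_def)

lemma cubic_form_swap:
  "cubic_form (swap_coeffs a) (prod.swap z) (prod.swap w) = cubic_form a z w"
  by (simp add: cubic_form_def swap_coeffs_def numeral_3_eq_3)

text \<open>Points of the real projective line: the tangent direction \<open>dy/dx\<close>, possibly infinite.\<close>

datatype direction = Slope real | Vertical

text \<open>\<open>affine_geodesic U a J t0 \<gamma> q p\<close>: on the open interval \<open>J\<close> the curve \<open>\<gamma>\<close> is the projection,
  distinct from a point, of an integral curve of the field that passes through \<open>(q; p)\<close> at
  time \<open>t0\<close>.\<close>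

definition affine_geodesic ::
  "(real \<times> real) set \<Rightarrow> coeffs \<Rightarrow> real set \<Rightarrow> real \<Rightarrow> (real \<Rightarrow> real \<times> real) \<Rightarrow> real \<times> real \<Rightarrow> real \<Rightarrow> bool"
  where
  "affine_geodesic U a J t0 \<gamma> q p \<longleftrightarrow> t0 \<in> J \<and> \<not> \<gamma> constant_on J \<and>
     (\<exists>\<sigma>. integral_curve (U \<times> UNIV) (V_field a) J \<sigma> \<and> \<sigma> t0 = (q, p) \<and> (\<forall>t\<in>J. \<gamma> t = fst (\<sigma> t)))"

text \<open>Geodesic arcs are taken short enough for the lift to stay in one affine chart of the
  fibre.\<close>

definition geodesic ::
  "(real \<times> real) set \<Rightarrow> coeffs \<Rightarrow> real set \<Rightarrow> real \<Rightarrow> (real \<Rightarrow> real \<times> real) \<Rightarrow> real \<times> real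
    \<Rightarrow> direction \<Rightarrow> bool" where
  "geodesic U a J t0 \<gamma> q d = (case d of
      Slope p \<Rightarrow> affine_geodesic U a J t0 \<gamma> q p
    | Vertical \<Rightarrow>
        affine_geodesic (prod.swap ` U) (swap_coeffs a) J t0 (prod.swap \<circ> \<gamma>) (prod.swap q) 0)"

text \<open>Existence, and uniqueness up to the choice of the arc and of the origin of the
  parameter of the integral curve.\<close>

definition unique_geodesic ::
  "(real \<times> real) set \<Rightarrow> coeffs \<Rightarrow> real \<times> real \<Rightarrow> direction \<Rightarrow> bool" where
  "unique_geodesic U a q d \<longleftrightarrow>
     (\<exists>J t0 \<gamma>. geodesic U a J t0 \<gamma> q d) \<and>
     (\<forall>J1 t1 \<gamma>1 J2 t2 \<gamma>2. geodesic U a J1 t1 \<gamma>1 q d \<and> geodesic U a J2 t2 \<gamma>2 q d \<longrightarrow>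
        (\<forall>s. t1 + s \<in> J1 \<and> t2 + s \<in> J2 \<longrightarrow> \<gamma>1 (t1 + s) = \<gamma>2 (t2 + s)))"


section \<open>Cuspidal and smooth curves\<close>

definition semicubic_cusp :: "(real \<times> real) set \<Rightarrow> real \<times> real \<Rightarrow> bool" where
  "semicubic_cusp C q \<longleftrightarrow>
     (\<exists>N \<Phi> :: real \<times> real \<Rightarrow> real \<times> real. diffeo_on N \<Phi> \<and> q \<in> N \<and> \<Phi> q = (0, 0) \<and>
        \<Phi> ` (C \<inter> N) = {(X, Y). Y\<^sup>2 = X ^ 3} \<inter> \<Phi> ` N)"

text \<open>The condition is imposed on all sufficiently short arcs around the parameter \<open>t0\<close>, so
  that later returns of the curve to the point \<open>\<gamma> t0\<close> are disregarded.\<close>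

definition semicubic_at :: "real set \<Rightarrow> real \<Rightarrow> (real \<Rightarrow> real \<times> real) \<Rightarrow> bool" where
  "semicubic_at J t0 \<gamma> \<longleftrightarrow>
     (\<forall>\<^sub>F e in at_right 0. semicubic_cusp (\<gamma> ` (J \<inter> ball t0 e)) (\<gamma> t0))"

definition regular_at :: "real set \<Rightarrow> real \<Rightarrow> (real \<Rightarrow> real \<times> real) \<Rightarrow> bool" where
  "regular_at J t0 \<gamma> \<longleftrightarrow>
     (\<exists>e>0. ball t0 e \<subseteq> J \<and> smooth_on (ball t0 e) \<gamma> \<and>
        (\<forall>t\<in>ball t0 e. vector_derivative \<gamma> (at t) \<noteq> 0))"


section \<open>Adapted coordinates\<close>

text \<open>In coordinates with \<open>a 3 = 0\<close> one writes \<open>F = A p\<^sup>2 + 2 B p + C\<close>, that is \<open>A = a 2\<close>,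
  \<open>B = a 1 / 2\<close>, \<open>C = a 0\<close>.\<close>

definition p_dir :: "coeffs \<Rightarrow> nat \<Rightarrow> real \<times> real \<Rightarrow> real" where
  "p_dir a i z = (let A = a 2 z; B = a 1 z / 2; C = a 0 z; \<delta> = sqrt (3 * (A * C - B\<^sup>2))
     in if i = 1 then (\<delta> - B) / A else (- \<delta> - B) / A)"

definition S_curve :: "(real \<times> real) set \<Rightarrow> coeffs \<Rightarrow> nat \<Rightarrow> (real \<times> real) set" where
  "S_curve U a i = {(x, y) \<in> M_minus U a. P_fun a x y (p_dir a i (x, y)) = 0}"

definition S_bar :: "(real \<times> real) set \<Rightarrow> coeffs \<Rightarrow> nat \<Rightarrow> ((real \<times> real) \<times> real) set" where
  "S_bar U a i = (\<lambda>z. (z, p_dir a i z)) ` S_curve U a i"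

lemma M_minus_adapted:
  assumes "a 3 z = 0" "A = a 2 z" "B = a 1 z / 2" "C = a 0 z"
  shows "discr a z = 4 * A\<^sup>2 * (B\<^sup>2 - A * C)"
    and "z \<in> M_minus U a \<longleftrightarrow> z \<in> U \<and> A * C - B\<^sup>2 > 0 \<and> A \<noteq> 0"
proof -
  show *: "discr a z = 4 * A\<^sup>2 * (B\<^sup>2 - A * C)"
    by (simp add: discr_def assms power2_eq_square power3_eq_cube algebra_simps)
  show "z \<in> M_minus U a \<longleftrightarrow> z \<in> U \<and> A * C - B\<^sup>2 > 0 \<and> A \<noteq> 0"
    by (auto simp: M_minus_def * mult_less_0_iff)
qed

lemma Delta_adapted:
  assumes "a 3 (x, y) = 0" "A = a 2 (x, y)" "B = a 1 (x, y) / 2" "C = a 0 (x, y)"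
  shows "Delta a x y p = - 2 * (A * p + B)\<^sup>2 + 6 * (A * C - B\<^sup>2)"
proof -
  have F: "cubic_poly a x y = (\<lambda>s. A * s\<^sup>2 + 2 * B * s + C)"
    using assms by (auto simp: cubic_poly_def numeral_3_eq_3 numeral_2_eq_2)
  have Fp: "F_p a x y s = 2 * A * s + 2 * B" for s
    unfolding F_p_def F by (rule DERIV_imp_deriv) (auto intro!: derivative_eq_intros)
  have Fpp: "F_pp a x y p = 2 * A"
    unfolding F_pp_def Fp by (rule DERIV_imp_deriv) (auto intro!: derivative_eq_intros)
  show ?thesis
    by (simp add: Delta_def Fp Fpp F power2_eq_square algebra_simps)
qed

end

theory Submission
  imports Defs
begin

text \<open>
  Geodesics are projections of integral curves of a smooth vector field on the space of directions, so
  existence and uniqueness of the geodesic with a given initial direction, finite or vertical, are the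
  Picard-Lindelof theorem (\<open>integral_curve_exists\<close>, \<open>integral_curve_unique\<close>).  Only the shape of the
  projection needs an argument, and it depends on whether \<open>\<Delta>\<close> vanishes.

  If \<open>\<Delta> \<noteq> 0\<close> at the initial direction, the velocity of the projection does not vanish and the geodesic is
  regular (\<open>regular_at_of_Delta_nonzero\<close>).  On \<open>M\<^sub>-\<close> this covers all directions except the two simple roots
  \<open>p\<^sub>1\<close> and \<open>p\<^sub>2\<close> of \<open>\<Delta>\<close>; the vertical one is a simple root of the cubic form, where \<open>\<Delta> \<noteq> 0\<close> in the
  second chart.

  At \<open>p = p\<^sub>i\<close> the field is \<open>P \<partial>\<^sub>p\<close> with \<open>P \<noteq> 0\<close>, because the point does not lie on \<open>S\<^sub>i\<close>.  Along the integral
  curve both \<open>\<Delta>\<close> and \<open>p - p\<^sub>i\<close> then have simple zeros in the time \<open>\<tau>\<close>.  As \<open>x' = \<Delta>\<close> and \<open>y' = p \<Delta>\<close>, the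
  function \<open>x - x\<^sub>0\<close> is \<open>\<tau>\<^sup>2\<close> times a unit and \<open>y - y\<^sub>0 - p\<^sub>i (x - x\<^sub>0)\<close> is \<open>\<tau>\<^sup>3\<close> times a unit
  (\<open>cusp_expansion\<close>).

  Such a curve is a semicubic parabola in suitable smooth coordinates
  (\<open>semicubic_at_of_factorization\<close>).  A change of the parameter turns the first function into \<open>\<plusminus>s\<^sup>2\<close> and the
  second one into \<open>s\<^sup>3 h(s)\<close>.  Whitney's theorem writes \<open>h(s) = \<alpha>(s\<^sup>2) + s \<beta>(s\<^sup>2)\<close> with smooth \<open>\<alpha>\<close> and \<open>\<beta>\<close>
  (\<open>even_odd_decomposition\<close>); hence \<open>s\<^sup>3\<close> is the restriction to the curve of a smooth function on the plane,
  which together with \<open>s\<^sup>2\<close> gives the required coordinates.  The delicate point in Whitney's theorem is that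
  \<open>\<alpha>\<close> and \<open>\<beta>\<close> have to be defined smoothly also for negative arguments, which no point of the curve reaches;
  Borel's theorem on functions with prescribed Taylor coefficients provides the extension
  (\<open>Borel_realization\<close>).
\<close>


section \<open>Calculus of smooth maps\<close>

lemma Ck_on_cong:
  assumes "open S" "\<And>z. z \<in> S \<Longrightarrow> f z = g z" "Ck_on k S f"
  shows "Ck_on k S g"
  using assms(2,3)
proof (induction k arbitrary: f g)
  case 0
  then show ?case
    by (auto intro: continuous_on_eq)
next
  case (Suc k)
  have D: "(g has_derivative frechet_derivative f (at z)) (at z)" if "z \<in> S" for z
  proof (rule has_derivative_transform_within_open[OF _ assms(1) that])
    show "(f has_derivative frechet_derivative f (at z)) (at z)"
      using Suc.prems that by (simp flip: frechet_derivative_works)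
  qed (use Suc.prems in auto)
  have "Ck_on k S (\<lambda>z. frechet_derivative g (at z) v)" for v
    by (rule Suc.IH[of "\<lambda>z. frechet_derivative f (at z) v"])
      (use Suc.prems fun_cong[OF frechet_derivative_at[OF D]] in auto)
  then show ?case
    using D by (auto simp: differentiable_def)
qed

lemma Ck_on_SucI:
  assumes "open S" "\<And>z. z \<in> S \<Longrightarrow> (f has_derivative f' z) (at z)"
    and "\<And>v. Ck_on k S (\<lambda>z. f' z v)"
  shows "Ck_on (Suc k) S f"
proof -
  have "Ck_on k S (\<lambda>z. frechet_derivative f (at z) v)" for v
    by (rule Ck_on_cong[OF assms(1) _ assms(3)[of v]])
      (use fun_cong[OF frechet_derivative_at[OF assms(2)]] in auto)
  then show ?thesis
    using assms(2) by (auto simp: differentiable_def)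
qed

lemma Ck_on_SucE:
  assumes "Ck_on (Suc k) S f"
  obtains f' where "\<And>z. z \<in> S \<Longrightarrow> (f has_derivative f' z) (at z)"
    "\<And>v. Ck_on k S (\<lambda>z. f' z v)"
  using assms by (auto simp flip: frechet_derivative_works intro!: that[of "\<lambda>z. frechet_derivative f (at z)"])

lemma Ck_on_imp_continuous_on: "Ck_on k S f \<Longrightarrow> continuous_on S f"
  by (cases k) (auto intro!: continuous_at_imp_continuous_on differentiable_imp_continuous_within)

lemma Ck_on_Suc_imp: "Ck_on (Suc k) S f \<Longrightarrow> Ck_on k S f"
proof (induction k arbitrary: f)
  case 0
  then show ?case
    by (auto intro!: continuous_at_imp_continuous_on differentiable_imp_continuous_within)
next
  case (Suc k)
  then show ?case by (metis Ck_on.simps(2))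
qed

lemma Ck_on_subset: "Ck_on k S f \<Longrightarrow> T \<subseteq> S \<Longrightarrow> Ck_on k T f"
  by (induction k arbitrary: f) (auto intro: continuous_on_subset)

lemma Ck_on_const: "open S \<Longrightarrow> Ck_on k S (\<lambda>z. c)"
proof (induction k arbitrary: c)
  case (Suc k)
  show ?case
    by (rule Ck_on_SucI[OF Suc.prems, where f' = "\<lambda>z v. 0"])
      (auto intro!: Suc)
qed auto

lemma Ck_on_bounded_linear:
  assumes "open S" "bounded_linear f"
  shows "Ck_on k S f"
proof (cases k)
  case 0
  then show ?thesis using assms(2) by (simp add: linear_continuous_on)
next
  case (Suc j)
  show ?thesis unfolding Suc
    by (rule Ck_on_SucI[OF assms(1), where f' = "\<lambda>z. f"])
      (auto intro!: Ck_on_const assms bounded_linear_imp_has_derivative)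
qed

lemma Ck_on_bounded_linear_compose:
  assumes "open S" "bounded_linear L" "Ck_on k S f"
  shows "Ck_on k S (\<lambda>z. L (f z))"
  using assms(3)
proof (induction k arbitrary: f)
  case 0
  then show ?case using assms(2) by (simp add: bounded_linear.continuous_on)
next
  case (Suc k)
  obtain f' where f': "\<And>z. z \<in> S \<Longrightarrow> (f has_derivative f' z) (at z)"
    "\<And>v. Ck_on k S (\<lambda>z. f' z v)" using Ck_on_SucE[OF Suc.prems] by blast
  show ?case
    by (rule Ck_on_SucI[OF assms(1), where f' = "\<lambda>z v. L (f' z v)"])
      (auto intro!: bounded_linear.has_derivative[OF assms(2)] Suc.IH f')
qed

lemma Ck_on_add:
  assumes "open S" "Ck_on k S f" "Ck_on k S g"
  shows "Ck_on k S (\<lambda>z. f z + g z)"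
  using assms(2,3)
proof (induction k arbitrary: f g)
  case 0
  then show ?case by (simp add: continuous_on_add)
next
  case (Suc k)
  obtain f' where f': "\<And>z. z \<in> S \<Longrightarrow> (f has_derivative f' z) (at z)"
    "\<And>v. Ck_on k S (\<lambda>z. f' z v)" using Ck_on_SucE[OF Suc.prems(1)] by blast
  obtain g' where g': "\<And>z. z \<in> S \<Longrightarrow> (g has_derivative g' z) (at z)"
    "\<And>v. Ck_on k S (\<lambda>z. g' z v)" using Ck_on_SucE[OF Suc.prems(2)] by blast
  show ?case
    by (rule Ck_on_SucI[OF assms(1), where f' = "\<lambda>z v. f' z v + g' z v"])
      (auto intro!: derivative_intros Suc.IH f' g')
qed

lemma Ck_on_bilinear:
  assumes "open S" "bounded_bilinear B" "Ck_on k S f" "Ck_on k S g"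
  shows "Ck_on k S (\<lambda>z. B (f z) (g z))"
  using assms(3,4)
proof (induction k arbitrary: f g)
  case 0
  then show ?case using assms(2) by (simp add: bounded_bilinear.continuous_on)
next
  case (Suc k)
  obtain f' where f': "\<And>z. z \<in> S \<Longrightarrow> (f has_derivative f' z) (at z)"
    "\<And>v. Ck_on k S (\<lambda>z. f' z v)" using Ck_on_SucE[OF Suc.prems(1)] by blast
  obtain g' where g': "\<And>z. z \<in> S \<Longrightarrow> (g has_derivative g' z) (at z)"
    "\<And>v. Ck_on k S (\<lambda>z. g' z v)" using Ck_on_SucE[OF Suc.prems(2)] by blast
  show ?case
    by (rule Ck_on_SucI[OF assms(1), where f' = "\<lambda>z v. B (f z) (g' z v) + B (f' z v) (g z)"])
      (auto intro!: bounded_bilinear.FDERIV[OF assms(2)] Suc.IH f' g' Ck_on_add assms(1)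
         Ck_on_Suc_imp[OF Suc.prems(1)] Ck_on_Suc_imp[OF Suc.prems(2)])
qed

lemma Ck_on_sum:
  assumes "open S" "\<And>i. i \<in> I \<Longrightarrow> Ck_on k S (f i)"
  shows "Ck_on k S (\<lambda>z. \<Sum>i\<in>I. f i z)"
  using assms(2)
  by (induction I rule: infinite_finite_induct) (auto intro!: Ck_on_const Ck_on_add assms(1))

text \<open>Induction on the order: the derivative of the composition is a sum of products of a derivative
  of the inner map with a composition of lower order.\<close>

lemma Ck_on_compose:
  fixes f :: "'a::euclidean_space \<Rightarrow> 'b::euclidean_space" and g :: "'b \<Rightarrow> 'c::real_normed_vector"
  assumes "open S" "open T" "Ck_on k S f" "Ck_on k T g" "f ` S \<subseteq> T"
  shows "Ck_on k S (\<lambda>z. g (f z))"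
  using assms(3,4)
proof (induction k arbitrary: g)
  case 0
  then show ?case using assms(5) by (auto intro: continuous_on_compose2)
next
  case (Suc k)
  obtain f' where f': "\<And>z. z \<in> S \<Longrightarrow> (f has_derivative f' z) (at z)"
    "\<And>v. Ck_on k S (\<lambda>z. f' z v)" using Ck_on_SucE[OF Suc.prems(1)] by blast
  obtain g' where g': "\<And>z. z \<in> T \<Longrightarrow> (g has_derivative g' z) (at z)"
    "\<And>v. Ck_on k T (\<lambda>z. g' z v)" using Ck_on_SucE[OF Suc.prems(2)] by blast
  have D: "((\<lambda>z. g (f z)) has_derivative (\<lambda>v. g' (f z) (f' z v))) (at z)" if "z \<in> S" for z
    using has_derivative_compose[OF f'(1)[OF that] g'(1)] that assms(5) by auto
  \<comment> \<open>Only the values of the outer derivative at constant vectors are covered by the induction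
    hypothesis, so it is expanded in the basis.\<close>
  have E: "g' (f z) w = (\<Sum>b\<in>Basis. (w \<bullet> b) *\<^sub>R g' (f z) b)" if "z \<in> S" for z w
  proof -
    have "linear (g' (f z))"
      using g'(1) that assms(5) has_derivative_bounded_linear bounded_linear.linear by blast
    then have "g' (f z) (\<Sum>b\<in>Basis. (w \<bullet> b) *\<^sub>R b) = (\<Sum>b\<in>Basis. (w \<bullet> b) *\<^sub>R g' (f z) b)"
      by (simp add: linear_sum linear_cmul)
    then show ?thesis
      by (simp add: euclidean_representation)
  qed
  have "Ck_on k S (\<lambda>z. \<Sum>b\<in>Basis. (f' z v \<bullet> b) *\<^sub>R g' (f z) b)" for v
    by (intro Ck_on_sum assms(1) Ck_on_bilinear[OF _ bounded_bilinear_scaleR]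
        Ck_on_bounded_linear_compose[OF _ bounded_linear_inner_left] f' Suc.IH g'
        Ck_on_Suc_imp[OF Suc.prems(1)])
  then have "Ck_on k S (\<lambda>z. g' (f z) (f' z v))" for v
    by (rule Ck_on_cong[OF assms(1), rotated]) (use E in auto)
  with D show ?case
    by (intro Ck_on_SucI[OF assms(1), where f' = "\<lambda>z v. g' (f z) (f' z v)"])
qed

lemma smooth_on_cong:
  "open S \<Longrightarrow> (\<And>z. z \<in> S \<Longrightarrow> f z = g z) \<Longrightarrow> smooth_on S f \<Longrightarrow> smooth_on S g"
  unfolding smooth_on_def using Ck_on_cong by blast

lemma smooth_on_imp_continuous_on: "smooth_on S f \<Longrightarrow> continuous_on S f"
  unfolding smooth_on_def using Ck_on_imp_continuous_on by blast

lemma smooth_on_imp_has_derivative: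
  "smooth_on S f \<Longrightarrow> z \<in> S \<Longrightarrow> (f has_derivative frechet_derivative f (at z)) (at z)"
  unfolding smooth_on_def by (metis Ck_on.simps(2) frechet_derivative_works)

lemma smooth_on_frechet_derivative:
  "smooth_on S f \<Longrightarrow> smooth_on S (\<lambda>z. frechet_derivative f (at z) v)"
  unfolding smooth_on_def by (metis Ck_on.simps(2))

lemma smooth_on_subset: "smooth_on S f \<Longrightarrow> T \<subseteq> S \<Longrightarrow> smooth_on T f"
  unfolding smooth_on_def using Ck_on_subset by blast

lemma smooth_on_const: "open S \<Longrightarrow> smooth_on S (\<lambda>z. c)"
  unfolding smooth_on_def using Ck_on_const by blast

lemma smooth_on_bounded_linear: "open S \<Longrightarrow> bounded_linear f \<Longrightarrow> smooth_on S f"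
  unfolding smooth_on_def using Ck_on_bounded_linear by blast

lemma smooth_on_bounded_linear_compose:
  "open S \<Longrightarrow> bounded_linear L \<Longrightarrow> smooth_on S f \<Longrightarrow> smooth_on S (\<lambda>z. L (f z))"
  unfolding smooth_on_def using Ck_on_bounded_linear_compose by blast

lemma smooth_on_add:
  "open S \<Longrightarrow> smooth_on S f \<Longrightarrow> smooth_on S g \<Longrightarrow> smooth_on S (\<lambda>z. f z + g z)"
  unfolding smooth_on_def using Ck_on_add by blast

lemma smooth_on_sum:
  "open S \<Longrightarrow> (\<And>i. i \<in> I \<Longrightarrow> smooth_on S (f i)) \<Longrightarrow> smooth_on S (\<lambda>z. \<Sum>i\<in>I. f i z)"
  unfolding smooth_on_def by (auto intro: Ck_on_sum)

lemma smooth_on_minus: "open S \<Longrightarrow> smooth_on S f \<Longrightarrow> smooth_on S (\<lambda>z. - f z)"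
  by (rule smooth_on_bounded_linear_compose[OF _ bounded_linear_minus[OF bounded_linear_ident]])

lemma smooth_on_diff:
  "open S \<Longrightarrow> smooth_on S f \<Longrightarrow> smooth_on S g \<Longrightarrow> smooth_on S (\<lambda>z. f z - g z)"
  using smooth_on_add[of S f "\<lambda>z. - g z"] smooth_on_minus[of S g] by simp

lemma smooth_on_mult:
  fixes f g :: "'a::euclidean_space \<Rightarrow> real"
  shows "open S \<Longrightarrow> smooth_on S f \<Longrightarrow> smooth_on S g \<Longrightarrow> smooth_on S (\<lambda>z. f z * g z)"
  unfolding smooth_on_def using Ck_on_bilinear[OF _ bounded_bilinear_mult] by blast

lemma smooth_on_power:
  fixes f :: "'a::euclidean_space \<Rightarrow> real"
  shows "open S \<Longrightarrow> smooth_on S f \<Longrightarrow> smooth_on S (\<lambda>z. f z ^ n)"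
  by (induction n) (auto intro: smooth_on_const smooth_on_mult)

lemma smooth_on_Pair:
  assumes "open S" "smooth_on S f" "smooth_on S g"
  shows "smooth_on S (\<lambda>z. (f z, g z))"
proof -
  have "smooth_on S (\<lambda>z. (f z, 0) + (0, g z))"
    by (intro smooth_on_add assms smooth_on_bounded_linear_compose[OF assms(1) _ assms(2)]
       smooth_on_bounded_linear_compose[OF assms(1) _ assms(3)])
      (auto intro!: bounded_linear_Pair bounded_linear_ident bounded_linear_zero)
  then show ?thesis by simp
qed

lemma smooth_on_compose:
  fixes f :: "'a::euclidean_space \<Rightarrow> 'b::euclidean_space"
  assumes "open S" "open T" "smooth_on S f" "smooth_on T g" "f ` S \<subseteq> T"
  shows "smooth_on S (\<lambda>z. g (f z))"
  using assms unfolding smooth_on_def by (blast intro: Ck_on_compose)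

text \<open>The derivative of the reciprocal is a polynomial in the reciprocal, so each order of
  differentiability yields the next one; the same bootstrapping serves for the square root below.\<close>

lemma smooth_on_inverse: "smooth_on (- {0}) (inverse :: real \<Rightarrow> real)"
  unfolding smooth_on_def
proof
  fix k
  show "Ck_on k (- {0}) (inverse :: real \<Rightarrow> real)"
  proof (induction k)
    case 0
    show ?case by (auto intro!: continuous_intros)
  next
    case (Suc k)
    have "Ck_on k (- {0}) (\<lambda>z. - v * (inverse z * inverse z))" for v :: real
      by (intro Ck_on_bounded_linear_compose[OF _ bounded_linear_mult_right]
          Ck_on_bilinear[OF _ bounded_bilinear_mult] Suc) auto
    then show ?case
      by (intro Ck_on_SucI[where f' = "\<lambda>z v. - v * (inverse z * inverse z)"])
        (auto intro!: derivative_eq_intros)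
  qed
qed

lemma smooth_on_sqrt: "smooth_on {0<..} sqrt"
  unfolding smooth_on_def
proof
  fix k
  show "Ck_on k {0<..} sqrt"
  proof (induction k)
    case 0
    show ?case by (auto intro!: continuous_intros)
  next
    case (Suc k)
    have "Ck_on k {0<..} (\<lambda>z. inverse (sqrt z))"
      by (rule Ck_on_compose[OF _ _ Suc, of "- {0}"]) (use smooth_on_inverse in \<open>auto simp: smooth_on_def\<close>)
    then have "Ck_on k {0<..} (\<lambda>z. (v / 2) * inverse (sqrt z))" for v :: real
      by (intro Ck_on_bounded_linear_compose[OF _ bounded_linear_mult_right]) auto
    then show ?case
      by (intro Ck_on_SucI[where f' = "\<lambda>z v. (v / 2) * inverse (sqrt z)"])
        (auto intro!: derivative_eq_intros simp: field_simps)
  qed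
qed

lemma smooth_on_divide:
  fixes f g :: "'a::euclidean_space \<Rightarrow> real"
  assumes "open S" "smooth_on S f" "smooth_on S g" "\<And>z. z \<in> S \<Longrightarrow> g z \<noteq> 0"
  shows "smooth_on S (\<lambda>z. f z / g z)"
  unfolding divide_inverse
  by (intro smooth_on_mult assms smooth_on_compose[OF _ _ _ smooth_on_inverse]) (use assms(4) in auto)

text \<open>For functions of one real variable smoothness amounts to an infinite chain of functions each of
  which is the derivative of the preceding one.  Integrals with a parameter, series and functions
  glued from two pieces are shown to be smooth below by writing down such a chain.\<close>

lemma smooth_on_real_sequenceI:
  fixes G :: "nat \<Rightarrow> real \<Rightarrow> real"
  assumes "open S" "\<And>k x. x \<in> S \<Longrightarrow> (G k has_real_derivative G (Suc k) x) (at x)"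
  shows "smooth_on S (G n)"
  unfolding smooth_on_def
proof
  fix k
  show "Ck_on k S (G n)"
  proof (induction k arbitrary: n)
    case 0
    show ?case using assms(2) by (auto intro!: continuous_at_imp_continuous_on intro: DERIV_isCont)
  next
    case (Suc k)
    show ?case
      by (rule Ck_on_SucI[OF assms(1), where f' = "\<lambda>x v. G (Suc n) x * v"])
        (auto intro!: Ck_on_bounded_linear_compose[OF _ bounded_linear_mult_left] assms(1) Suc
           assms(2)[THEN has_field_derivative_imp_has_derivative])
  qed
qed

lemma smooth_on_realE:
  fixes f :: "real \<Rightarrow> real"
  assumes "smooth_on S f"
  obtains f' where "smooth_on S f'" "\<And>x. x \<in> S \<Longrightarrow> (f has_real_derivative f' x) (at x)"
proof
  show "smooth_on S (\<lambda>z. frechet_derivative f (at z) 1)"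
    by (rule smooth_on_frechet_derivative[OF assms])
  fix x assume "x \<in> S"
  then have D: "(f has_derivative frechet_derivative f (at x)) (at x)"
    by (rule smooth_on_imp_has_derivative[OF assms])
  have "frechet_derivative f (at x) h = frechet_derivative f (at x) 1 * h" for h
    using linear_cmul[OF has_derivative_linear[OF D], of h 1] by simp
  then have "frechet_derivative f (at x) = (*) (frechet_derivative f (at x) 1)"
    by (rule ext)
  with D show "(f has_real_derivative frechet_derivative f (at x) 1) (at x)"
    unfolding has_field_derivative_def by metis
qed

lemma smooth_on_real_sequenceE:
  fixes f :: "real \<Rightarrow> real"
  assumes "smooth_on S f"
  obtains G where "G 0 = f" "\<And>k. smooth_on S (G k)"
    "\<And>k x. x \<in> S \<Longrightarrow> (G k has_real_derivative G (Suc k) x) (at x)"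
proof -
  have "\<forall>g. smooth_on S g \<longrightarrow> (\<exists>g'. smooth_on S g' \<and>
      (\<forall>x\<in>S. (g has_real_derivative g' x) (at x)))" using smooth_on_realE by metis
  then obtain d where d: "\<And>g. smooth_on S g \<Longrightarrow> smooth_on S (d g)"
    "\<And>g x. smooth_on S g \<Longrightarrow> x \<in> S \<Longrightarrow> (g has_real_derivative d g x) (at x)" by metis
  define G where "G k = (d ^^ k) f" for k
  have "smooth_on S (G k)" for k
    by (induction k) (auto simp: G_def assms d)
  then show thesis
    by (intro that[of G]) (auto simp: G_def d)
qed

lemmas smooth_on_intros = smooth_on_const smooth_on_add smooth_on_minus smooth_on_diff
  smooth_on_mult smooth_on_power smooth_on_Pair


section \<open>Integral curves of smooth vector fields\<close>

text \<open>The solution is the fixed point of the Picard operator on bounded continuous functions on the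
  whole line.  Two retractions make the operator globally defined: the field is precomposed with
  the nearest-point projection onto the ball, which does not increase distances, and time is
  clamped to \<open>[-h, h]\<close>.  For small \<open>h\<close> the operator is a contraction and its fixed point stays in
  the ball, where the retraction changes nothing.\<close>

lemma Picard_Lindelof_local:
  fixes X :: "'a::euclidean_space \<Rightarrow> 'a"
  assumes L: "L-lipschitz_on (cball z0 r) X" and r: "r > 0"
  obtains h \<sigma> where "h > 0" "\<sigma> 0 = z0" "\<And>t. \<bar>t\<bar> < h \<Longrightarrow> \<sigma> t \<in> cball z0 r"
    "\<And>t. \<bar>t\<bar> < h \<Longrightarrow> (\<sigma> has_vector_derivative X (\<sigma> t)) (at t)"
proof -
  define K where "K = cball z0 r"
  have K: "convex K" "closed K" "K \<noteq> {}" "compact K" "z0 \<in> K"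
    using r by (auto simp: K_def)
  define c where "c = closest_point K"
  have c_in: "c z \<in> K" for z
    using closest_point_in_set K by (simp add: c_def)
  have c_lip: "dist (c u) (c v) \<le> dist u v" for u v
    unfolding c_def by (rule closest_point_lipschitz) (use K in auto)
  have c_id: "c z = z" if "z \<in> K" for z
    using that by (simp add: c_def closest_point_self)
  define Y where "Y = (\<lambda>z. X (c z))"
  have L0: "L \<ge> 0" using L lipschitz_on_nonneg by blast
  have Y_lip: "norm (Y u - Y v) \<le> L * dist u v" for u v
  proof -
    have "dist (X (c u)) (X (c v)) \<le> L * dist (c u) (c v)"
      using lipschitz_onD[OF L] c_in unfolding K_def by blast
    also have "\<dots> \<le> L * dist u v"
      using c_lip L0 by (simp add: mult_left_mono)
    finally show ?thesis by (simp add: Y_def dist_norm)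
  qed
  then have Y_cont: "continuous_on UNIV Y"
    by (intro lipschitz_on_continuous_on[of L] lipschitz_onI) (auto simp: dist_norm L0)
  have "bounded (X ` K)"
    using lipschitz_on_continuous_on[OF L] K(4) compact_continuous_image compact_imp_bounded
    unfolding K_def by blast
  then obtain M where M: "M > 0" "\<And>z. z \<in> K \<Longrightarrow> norm (X z) \<le> M"
    unfolding bounded_pos by auto
  have Y_bd: "norm (Y z) \<le> M" for z using M c_in by (simp add: Y_def)
  \<comment> \<open>The operator contains two integrals, over intervals of length at most \<open>2 * h\<close> and equal to \<open>h\<close>,
    hence the factor \<open>3\<close> in both bounds.\<close>
  define h where "h = min (r / (3 * M)) (1 / (6 * (L + 1)))"
  have h0: "h > 0" using r M L0 by (simp add: h_def)
  have hM: "3 * h * M \<le> r"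
  proof -
    have "h \<le> r / (3 * M)" by (simp add: h_def)
    then show ?thesis using M by (simp add: field_simps)
  qed
  have hL: "3 * h * L \<le> 1 / 2"
  proof -
    have "h \<le> 1 / (6 * (L + 1))" by (simp add: h_def)
    then have "6 * (h * (L + 1)) \<le> 1" using L0 by (simp add: field_simps)
    then show ?thesis using h0 by (simp add: algebra_simps)
  qed
  define cl where "cl = (\<lambda>t. max (- h) (min h t))"
  have cl: "cl t \<in> {-h..h}" for t using h0 by (auto simp: cl_def)
  have cl_cont: "continuous_on UNIV cl"
    unfolding cl_def by (intro continuous_intros)
  define I where "I = (\<lambda>(\<sigma> :: real \<Rightarrow> 'a) u. integral {-h..u} (\<lambda>s. Y (\<sigma> s)))"
  have Ys_cont: "continuous_on S (\<lambda>s. Y (\<sigma> s))" if "continuous_on UNIV \<sigma>" for \<sigma> :: "real \<Rightarrow> 'a" and S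
    using continuous_on_compose2[OF Y_cont that] continuous_on_subset by blast
  have Ys_int: "(\<lambda>s. Y (\<sigma> s)) integrable_on {u..v}" if "continuous_on UNIV \<sigma>" for \<sigma> :: "real \<Rightarrow> 'a" and u v
    by (rule integrable_continuous_real[OF Ys_cont[OF that]])
  have I_bd: "norm (I \<sigma> u) \<le> M * (u + h)" if "continuous_on UNIV \<sigma>" "u \<in> {-h..h}" for \<sigma> u
    unfolding I_def using integral_bound[of "-h" u "\<lambda>s. Y (\<sigma> s)" M] that Y_bd Ys_cont by auto
  have I_lip: "norm (I \<sigma> u - I \<rho> u) \<le> (L * D) * (u + h)"
    if "continuous_on UNIV \<sigma>" "continuous_on UNIV \<rho>" "u \<in> {-h..h}" "\<And>s. dist (\<sigma> s) (\<rho> s) \<le> D" for \<sigma> \<rho> u D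
  proof -
    have "norm (integral {-h..u} (\<lambda>s. Y (\<sigma> s) - Y (\<rho> s))) \<le> (L * D) * (u - (-h))"
    proof (rule integral_bound)
      show "norm (Y (\<sigma> s) - Y (\<rho> s)) \<le> L * D" for s
        using Y_lip[of "\<sigma> s" "\<rho> s"] that(4)[of s] L0 mult_left_mono[OF that(4)[of s] L0] by linarith
    qed (use that Ys_cont in \<open>auto intro!: continuous_on_diff\<close>)
    then show ?thesis
      unfolding I_def using Ys_int that by (subst integral_diff[symmetric]) auto
  qed
  \<comment> \<open>Integrals are taken from the left end \<open>-h\<close>, because the integral over \<open>{0..u}\<close> is \<open>0\<close> for negative
    \<open>u\<close>.\<close>
  define T where "T = (\<lambda>\<sigma> t. z0 + I \<sigma> (cl t) - I \<sigma> 0)"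
  have T_bcont: "T \<sigma> \<in> bcontfun" if "continuous_on UNIV \<sigma>" for \<sigma>
  proof (rule bcontfun_normI)
    have "continuous_on {-h..h} (I \<sigma>)"
      unfolding I_def by (rule indefinite_integral_continuous_1[OF Ys_int[OF that]])
    then have "continuous_on UNIV (\<lambda>t. I \<sigma> (cl t))"
      by (rule continuous_on_compose2[OF _ cl_cont]) (use cl in auto)
    then show "continuous_on UNIV (T \<sigma>)"
      unfolding T_def by (intro continuous_intros)
    show "norm (T \<sigma> t) \<le> norm z0 + 2 * h * M + h * M" for t
    proof -
      have "norm (I \<sigma> (cl t)) \<le> M * (2 * h)"
        using I_bd[OF that cl, of t] cl[of t] M by (smt (verit) atLeastAtMost_iff mult_left_mono)
      moreover have "norm (I \<sigma> 0) \<le> M * h"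
        using I_bd[OF that, of 0] h0 by simp
      ultimately show ?thesis
        unfolding T_def
        using norm_triangle_ineq[of z0 "I \<sigma> (cl t)"] norm_triangle_ineq4[of "z0 + I \<sigma> (cl t)" "I \<sigma> 0"]
        by (simp add: algebra_simps)
    qed
  qed
  have "\<exists>!f. Bcontfun (T (apply_bcontfun f)) = f"
  proof (rule banach_fix_type[of "1/2"], safe)
    fix f g :: "real \<Rightarrow>\<^sub>C 'a"
    define \<sigma> \<rho> where "\<sigma> = apply_bcontfun f" "\<rho> = apply_bcontfun g"
    note d = this
    have cont: "continuous_on UNIV \<sigma>" "continuous_on UNIV \<rho>" unfolding d by auto
    have D: "dist (\<sigma> s) (\<rho> s) \<le> dist f g" for s unfolding d by (rule dist_bounded)
    have *: "norm (I \<sigma> u - I \<rho> u) \<le> (L * dist f g) * (u + h)" if "u \<in> {-h..h}" for u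
      using I_lip[OF cont that D] .
    show "dist (Bcontfun (T \<sigma>)) (Bcontfun (T \<rho>)) \<le> 1/2 * dist f g"
    proof (rule dist_bound)
      fix t
      have "norm (T \<sigma> t - T \<rho> t) \<le> norm (I \<sigma> (cl t) - I \<rho> (cl t)) + norm (I \<sigma> 0 - I \<rho> 0)"
        unfolding T_def
        using norm_triangle_ineq4[of "I \<sigma> (cl t) - I \<rho> (cl t)" "I \<sigma> 0 - I \<rho> 0"]
        by (simp add: algebra_simps)
      also have "\<dots> \<le> (L * dist f g) * (2 * h) + (L * dist f g) * h"
      proof (rule add_mono)
        show "norm (I \<sigma> (cl t) - I \<rho> (cl t)) \<le> L * dist f g * (2 * h)"
          by (rule order_trans[OF *[OF cl] mult_left_mono]) (use cl[of t] L0 in auto)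
        show "norm (I \<sigma> 0 - I \<rho> 0) \<le> L * dist f g * h"
          using *[of 0] h0 by simp
      qed
      also have "\<dots> = (3 * h * L) * dist f g" by (simp add: algebra_simps)
      also have "\<dots> \<le> 1/2 * dist f g" using hL by (intro mult_right_mono) auto
      finally show "dist (Bcontfun (T \<sigma>) t) (Bcontfun (T \<rho>) t) \<le> 1/2 * dist f g"
        by (simp add: Bcontfun_inverse T_bcont cont dist_norm)
    qed
  qed auto
  then obtain f where f: "Bcontfun (T (apply_bcontfun f)) = f" by blast
  define \<sigma> where "\<sigma> = apply_bcontfun f"
  have cont: "continuous_on UNIV \<sigma>" unfolding \<sigma>_def by auto
  have fix_\<sigma>: "\<sigma> t = z0 + I \<sigma> (cl t) - I \<sigma> 0" for t
    using f T_bcont[OF cont] unfolding \<sigma>_def by (metis Bcontfun_inverse T_def)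
  have \<sigma>_in: "\<sigma> t \<in> K" for t
  proof -
    have "norm (I \<sigma> (cl t)) \<le> M * (2 * h)"
      by (rule order_trans[OF I_bd[OF cont cl] mult_left_mono]) (use cl[of t] M in auto)
    moreover have "norm (I \<sigma> 0) \<le> M * h"
      using I_bd[OF cont, of 0] h0 by simp
    ultimately have "norm (I \<sigma> (cl t) - I \<sigma> 0) \<le> 3 * h * M"
      using norm_triangle_ineq4[of "I \<sigma> (cl t)" "I \<sigma> 0"] by (simp add: algebra_simps)
    moreover have "dist z0 (\<sigma> t) = norm (I \<sigma> (cl t) - I \<sigma> 0)"
      by (subst dist_commute) (simp add: dist_norm fix_\<sigma>[of t])
    ultimately show ?thesis using hM by (simp add: K_def)
  qed
  have deriv: "(\<sigma> has_vector_derivative X (\<sigma> t)) (at t)" if "\<bar>t\<bar> < h" for t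
  proof -
    have "(I \<sigma> has_vector_derivative Y (\<sigma> t)) (at t within {-h..h})"
      unfolding I_def
      by (rule integral_has_vector_derivative[OF Ys_cont[OF cont]]) (use that in auto)
    then have "(I \<sigma> has_vector_derivative Y (\<sigma> t)) (at t)"
      using that by (subst (asm) at_within_interior) auto
    then have "((\<lambda>u. z0 + I \<sigma> u - I \<sigma> 0) has_vector_derivative Y (\<sigma> t)) (at t)"
      by (auto intro!: derivative_eq_intros)
    then have "(\<sigma> has_vector_derivative Y (\<sigma> t)) (at t)"
      by (rule has_vector_derivative_transform_within_open[where S = "{-h<..<h}"])
        (use that fix_\<sigma> in \<open>auto simp: cl_def\<close>)
    then show ?thesis using c_id[OF \<sigma>_in] by (simp add: Y_def)
  qed
  have "\<sigma> 0 = z0" using fix_\<sigma>[of 0] h0 by (simp add: cl_def)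
  with h0 \<sigma>_in deriv show thesis
    by (intro that[of h \<sigma>]) (auto simp: K_def)
qed

text \<open>The derivative is bounded in operator norm by the sum of the norms of the partial derivatives,
  and these are bounded on the compact ball.\<close>

lemma C1_imp_lipschitz_on_cball:
  fixes X :: "'a::euclidean_space \<Rightarrow> 'b::real_normed_vector"
  assumes "Ck_on 1 W X" "cball z r \<subseteq> W"
  obtains L where "L-lipschitz_on (cball z r) X"
proof -
  let ?D = "\<lambda>w. frechet_derivative X (at w)"
  have D: "(X has_derivative ?D w) (at w)" if "w \<in> cball z r" for w
    using assms that by (auto simp flip: frechet_derivative_works)
  have "continuous_on (cball z r) (\<lambda>w. \<Sum>b\<in>Basis. norm (?D w b))"
    using assms by (intro continuous_intros) (auto intro: continuous_on_subset)
  then have "bounded ((\<lambda>w. \<Sum>b\<in>Basis. norm (?D w b)) ` cball z r)"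
    by (intro compact_imp_bounded compact_continuous_image) auto
  then obtain B where B: "B > 0" "\<And>w. w \<in> cball z r \<Longrightarrow> (\<Sum>b\<in>Basis. norm (?D w b)) \<le> B"
    unfolding bounded_pos by (auto simp: abs_le_iff)
  have on: "onorm (?D w) \<le> B" if w: "w \<in> cball z r" for w
  proof (rule onorm_le)
    fix v
    have lin: "linear (?D w)" using D[OF w] by (rule has_derivative_linear)
    have "?D w v = ?D w (\<Sum>b\<in>Basis. (v \<bullet> b) *\<^sub>R b)"
      by (simp add: euclidean_representation)
    also have "\<dots> = (\<Sum>b\<in>Basis. (v \<bullet> b) *\<^sub>R ?D w b)"
      by (simp add: linear_sum[OF lin] linear_cmul[OF lin])
    also have "norm \<dots> \<le> (\<Sum>b\<in>Basis. norm v * norm (?D w b))"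
      by (rule sum_norm_le) (auto intro!: mult_right_mono Basis_le_norm)
    also have "\<dots> = norm v * (\<Sum>b\<in>Basis. norm (?D w b))" by (simp add: sum_distrib_left)
    also have "\<dots> \<le> B * norm v"
      using mult_left_mono[OF B(2)[OF w] norm_ge_zero[of v]] by (simp only: mult.commute)
    finally show "norm (?D w v) \<le> B * norm v" .
  qed
  have "B-lipschitz_on (cball z r) X"
  proof (rule lipschitz_onI)
    fix u v assume "u \<in> cball z r" "v \<in> cball z r"
    then show "dist (X u) (X v) \<le> B * dist u v"
      unfolding dist_norm
      by (intro differentiable_bound[where S = "cball z r" and f' = ?D])
        (auto intro: has_derivative_at_withinI D on simp del: mem_cball)
  qed (use B in auto)
  then show thesis by (rule that)
qed

lemma integral_curve_exists:
  fixes X :: "'a::euclidean_space \<Rightarrow> 'a"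
  assumes "open W" "Ck_on 1 W X" "z0 \<in> W"
  obtains J \<sigma> where "0 \<in> J" "integral_curve W X J \<sigma>" "\<sigma> 0 = z0"
proof -
  obtain r where r: "r > 0" "cball z0 r \<subseteq> W" using assms open_contains_cball by blast
  obtain L where "L-lipschitz_on (cball z0 r) X" using C1_imp_lipschitz_on_cball assms r by blast
  from Picard_Lindelof_local[OF this r(1)] obtain h \<sigma> where h: "h > 0" "\<sigma> 0 = z0"
    "\<And>t. \<bar>t\<bar> < h \<Longrightarrow> \<sigma> t \<in> cball z0 r"
    "\<And>t. \<bar>t\<bar> < h \<Longrightarrow> (\<sigma> has_vector_derivative X (\<sigma> t)) (at t)" by blast
  have "integral_curve W X {-h<..<h} \<sigma>"
    unfolding integral_curve_def using h(3,4) subsetD[OF r(2)] by (auto simp: is_interval_oo)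
  with h show thesis by (intro that[of "{-h<..<h}" \<sigma>]) auto
qed

lemma integral_curve_continuous_on: "integral_curve W X J \<sigma> \<Longrightarrow> continuous_on J \<sigma>"
  unfolding integral_curve_def
  by (auto intro!: continuous_at_imp_continuous_on has_vector_derivative_continuous)

text \<open>The field is autonomous, so the origin of time is arbitrary; this reduces statements about two
  curves with different base times to a common one.\<close>

lemma integral_curve_shift:
  assumes "integral_curve W X J \<sigma>"
  shows "integral_curve W X {s. c + s \<in> J} (\<lambda>s. \<sigma> (c + s))"
proof -
  have eq: "{s. c + s \<in> J} = (+) (- c) ` J"
    by (force simp: image_iff)
  have "((\<lambda>s. \<sigma> (c + s)) has_vector_derivative X (\<sigma> (c + s))) (at s)" if "c + s \<in> J" for s
  proof -
    have "(\<sigma> \<circ> (\<lambda>s. c + s) has_vector_derivative 1 *\<^sub>R X (\<sigma> (c + s))) (at s)"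
      using assms that unfolding integral_curve_def
      by (intro vector_diff_chain_at) (auto intro!: derivative_eq_intros)
    then show ?thesis by (simp add: o_def)
  qed
  moreover have "open {s. c + s \<in> J}" "is_interval {s. c + s \<in> J}"
    using assms open_translation[of J "- c"] unfolding eq integral_curve_def
    by (auto simp: is_interval_translation)
  ultimately show ?thesis using assms unfolding integral_curve_def by auto
qed

text \<open>On a time interval of half-length \<open>e\<close> with \<open>L * e \<le> 1 / 2\<close> the mean value inequality bounds the
  maximal distance of the two curves by half of itself, so it vanishes.\<close>

lemma integral_curve_unique_near:
  fixes X :: "'a::euclidean_space \<Rightarrow> 'a"
  assumes "open W" "Ck_on 1 W X" "integral_curve W X J \<sigma>" "integral_curve W X J \<rho>"
    and "t0 \<in> J" "\<sigma> t0 = \<rho> t0"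
  obtains e where "e > 0" "ball t0 e \<subseteq> J" "\<And>t. t \<in> ball t0 e \<Longrightarrow> \<sigma> t = \<rho> t"
proof -
  have z: "\<sigma> t0 \<in> W" and J: "open J" using assms unfolding integral_curve_def by auto
  obtain r where r: "r > 0" "cball (\<sigma> t0) r \<subseteq> W" using assms z open_contains_cball by blast
  obtain L where L: "L-lipschitz_on (cball (\<sigma> t0) r) X"
    using C1_imp_lipschitz_on_cball assms r by blast
  have L0: "L \<ge> 0" using L lipschitz_on_nonneg by blast
  have "open (J \<inter> \<sigma> -` ball (\<sigma> t0) r)" "open (J \<inter> \<rho> -` ball (\<sigma> t0) r)"
    using integral_curve_continuous_on assms(3,4) J
    by (meson continuous_open_preimage open_ball)+
  then have "open ((J \<inter> \<sigma> -` ball (\<sigma> t0) r) \<inter> (J \<inter> \<rho> -` ball (\<sigma> t0) r))" (is "open ?V") by blast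
  moreover have "t0 \<in> ?V" using assms r by auto
  ultimately obtain e0 where e0: "e0 > 0" "cball t0 e0 \<subseteq> ?V" using open_contains_cball by meson
  define e where "e = min e0 (1 / (2 * (L + 1)))"
  have e: "e > 0" "cball t0 e \<subseteq> ?V" using e0 L0 by (auto simp: e_def)
  have eL: "L * e \<le> 1 / 2"
  proof -
    have "e \<le> 1 / (2 * (L + 1))" by (simp add: e_def)
    then have "2 * (e * (L + 1)) \<le> 1" using L0 by (simp add: field_simps)
    then show ?thesis using e(1) by (simp add: algebra_simps)
  qed
  define d where "d = (\<lambda>t. \<sigma> t - \<rho> t)"
  have d_cont: "continuous_on (cball t0 e) d"
    unfolding d_def using e integral_curve_continuous_on assms(3,4)
    by (intro continuous_intros) (blast intro: continuous_on_subset)+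
  then have "continuous_on (cball t0 e) (\<lambda>t. norm (d t))" by (intro continuous_intros)
  from continuous_attains_sup[OF _ _ this]
  obtain tm where tm: "tm \<in> cball t0 e" "\<And>t. t \<in> cball t0 e \<Longrightarrow> norm (d t) \<le> norm (d tm)"
    using e by auto
  have D: "(d has_derivative (\<lambda>h. h *\<^sub>R (X (\<sigma> t) - X (\<rho> t)))) (at t within cball t0 e)"
    if "t \<in> cball t0 e" for t
  proof -
    have "t \<in> J" using that e by auto
    then have "(d has_vector_derivative X (\<sigma> t) - X (\<rho> t)) (at t)"
      using assms(3,4) unfolding d_def integral_curve_def by (auto intro!: derivative_intros)
    then show ?thesis unfolding has_vector_derivative_def by (rule has_derivative_at_withinI)
  qed
  have on: "onorm (\<lambda>h. h *\<^sub>R (X (\<sigma> t) - X (\<rho> t))) \<le> L * norm (d tm)" if "t \<in> cball t0 e" for t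
  proof (rule onorm_le)
    fix h :: real
    have "norm (X (\<sigma> t) - X (\<rho> t)) \<le> L * norm (d t)"
      using lipschitz_onD[OF L, of "\<sigma> t" "\<rho> t"] that e by (force simp: dist_norm d_def)
    also have "\<dots> \<le> L * norm (d tm)" using tm(2)[OF that] L0 by (rule mult_left_mono)
    finally show "norm (h *\<^sub>R (X (\<sigma> t) - X (\<rho> t))) \<le> L * norm (d tm) * norm h"
      by (simp add: mult.commute mult_left_mono)
  qed
  have "norm (d tm - d t0) \<le> L * norm (d tm) * norm (tm - t0)"
    by (rule differentiable_bound[OF _ D on]) (use tm e in auto)
  also have "\<dots> \<le> L * norm (d tm) * e"
    using tm(1) L0 by (intro mult_left_mono) (auto simp: dist_real_def)
  also have "\<dots> \<le> 1/2 * norm (d tm)" using mult_right_mono[OF eL, of "norm (d tm)"] by (simp add: algebra_simps)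
  finally have "norm (d tm) \<le> 1/2 * norm (d tm)" using assms(6) by (simp add: d_def)
  then have "norm (d tm) = 0" by simp
  then have "\<sigma> t = \<rho> t" if "t \<in> ball t0 e" for t
    using tm(2)[of t] that by (simp add: d_def)
  then show thesis using e by (intro that[of e]) auto
qed

text \<open>The coincidence set is closed, and it is open by the local statement; the interval is
  connected.\<close>

lemma integral_curve_unique:
  fixes X :: "'a::euclidean_space \<Rightarrow> 'a"
  assumes "open W" "Ck_on 1 W X" "integral_curve W X J \<sigma>" "integral_curve W X J \<rho>"
    and "t0 \<in> J" "\<sigma> t0 = \<rho> t0" "t \<in> J"
  shows "\<sigma> t = \<rho> t"
proof -
  let ?E = "{t \<in> J. \<sigma> t - \<rho> t = 0}"
  have "connected J"
    using assms(3) unfolding integral_curve_def by (simp add: is_interval_connected)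
  moreover have "openin (top_of_set J) ?E"
  proof -
    have "open ?E"
      unfolding open_contains_ball
    proof safe
      fix s assume "s \<in> J" "\<sigma> s - \<rho> s = 0"
      then obtain e where "e > 0" "ball s e \<subseteq> J" "\<And>t. t \<in> ball s e \<Longrightarrow> \<sigma> t = \<rho> t"
        using integral_curve_unique_near[OF assms(1-4), of s] by auto
      then show "\<exists>e>0. ball s e \<subseteq> ?E" by (intro exI[of _ e]) auto
    qed
    then show ?thesis by (simp add: open_subset)
  qed
  moreover have "closedin (top_of_set J) ?E"
    by (rule continuous_closedin_preimage_constant)
      (intro continuous_on_diff integral_curve_continuous_on[OF assms(3)]
        integral_curve_continuous_on[OF assms(4)])
  ultimately have "?E = {} \<or> ?E = J" unfolding connected_clopen by blast
  then show ?thesis using assms(5-7) by auto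
qed

text \<open>Bootstrapping: the derivative \<open>X \<circ> \<sigma>\<close> is as smooth as \<open>\<sigma>\<close> itself, so \<open>\<sigma>\<close> is one order smoother.
  Besides geodesics, this is used for the inverse of a function of one variable.\<close>

lemma integral_curve_smooth:
  fixes X :: "'a::euclidean_space \<Rightarrow> 'a"
  assumes "open W" "smooth_on W X" "integral_curve W X J \<sigma>"
  shows "smooth_on J \<sigma>"
  unfolding smooth_on_def
proof
  have J: "open J" "\<sigma> ` J \<subseteq> W" using assms(3) unfolding integral_curve_def by auto
  fix k
  show "Ck_on k J \<sigma>"
  proof (induction k)
    case 0
    show ?case using integral_curve_continuous_on[OF assms(3)] by simp
  next
    case (Suc k)
    have "Ck_on k J (\<lambda>t. X (\<sigma> t))"
      by (rule Ck_on_compose[OF J(1) assms(1) Suc _ J(2)]) (use assms(2) in \<open>simp add: smooth_on_def\<close>)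
    then show ?case
      using assms(3) unfolding integral_curve_def has_vector_derivative_def
      by (intro Ck_on_SucI[where f' = "\<lambda>t h. h *\<^sub>R X (\<sigma> t)"] J
          Ck_on_bounded_linear_compose[OF _ bounded_linear_scaleR_right]) auto
  qed
qed


section \<open>Division by powers and even functions of one variable\<close>

text \<open>Differentiation under the integral sign; iterated, it shows that the integral is smooth in
  \<open>x\<close>.\<close>

lemma scaled_average_has_derivative:
  fixes w w' :: "real \<Rightarrow> real"
  assumes "smooth_on (ball 0 r) w" "x \<in> ball 0 r"
    and "\<And>x. x \<in> ball 0 r \<Longrightarrow> (w has_real_derivative w' x) (at x)"
    and "smooth_on (ball 0 r) w'"
  shows "((\<lambda>x. integral {0..1} (\<lambda>\<theta>. \<theta> ^ n * w (\<theta> * x))) has_real_derivative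
    integral {0..1} (\<lambda>\<theta>. \<theta> ^ Suc n * w' (\<theta> * x))) (at x)"
proof -
  have in_ball: "\<theta> * y \<in> ball 0 r" if "y \<in> ball 0 r" "\<theta> \<in> cbox 0 1" for \<theta> y :: real
    using that mult_left_le_one_le[of "\<bar>y\<bar>" \<theta>] by (simp add: abs_mult)
  have "((\<lambda>x. integral (cbox 0 1) (\<lambda>\<theta>. \<theta> ^ n * w (\<theta> * x))) has_real_derivative
    integral (cbox 0 1) (\<lambda>\<theta>. \<theta> ^ Suc n * w' (\<theta> * x))) (at x within ball 0 r)"
  proof (rule leibniz_rule_field_derivative[where U = "ball 0 r"
        and f = "\<lambda>y \<theta>. \<theta> ^ n * w (\<theta> * y)" and fx = "\<lambda>y \<theta>. \<theta> ^ Suc n * w' (\<theta> * y)"])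
    fix y \<theta> :: real assume y: "y \<in> ball 0 r" "\<theta> \<in> cbox 0 1"
    then have "(w has_real_derivative w' (\<theta> * y)) (at (\<theta> * y))"
      using assms(3) in_ball by auto
    then have "((\<lambda>y. w (\<theta> * y)) has_real_derivative w' (\<theta> * y) * \<theta>) (at y within ball 0 r)"
      by (rule DERIV_chain2) (auto intro!: derivative_eq_intros)
    then show "((\<lambda>y. \<theta> ^ n * w (\<theta> * y)) has_real_derivative \<theta> ^ Suc n * w' (\<theta> * y)) (at y within ball 0 r)"
      by (auto intro!: derivative_eq_intros)
  next
    fix y :: real assume y: "y \<in> ball 0 r"
    show "(\<lambda>\<theta>. \<theta> ^ n * w (\<theta> * y)) integrable_on cbox 0 1"
      by (intro integrable_continuous continuous_intros
          continuous_on_compose2[OF smooth_on_imp_continuous_on[OF assms(1)]]) (use in_ball y in auto)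
  next
    have "(\<lambda>p :: real \<times> real. snd p * fst p) ` (ball 0 r \<times> cbox 0 1) \<subseteq> ball 0 r"
    proof (rule image_subsetI)
      fix p :: "real \<times> real" assume "p \<in> ball 0 r \<times> cbox 0 1"
      then show "snd p * fst p \<in> ball 0 r"
        using in_ball[of "fst p" "snd p"] by (simp add: mem_Times_iff del: mem_ball mem_ball_0)
    qed
    then show "continuous_on (ball 0 r \<times> cbox 0 1) (\<lambda>(y, \<theta>). \<theta> ^ Suc n * w' (\<theta> * y))"
      unfolding case_prod_beta
      by (intro continuous_intros continuous_on_compose2[OF smooth_on_imp_continuous_on[OF assms(4)]])
  qed (use assms in auto)
  then show ?thesis
    by (simp add: at_within_open[OF assms(2) open_ball])
qed

text \<open>Hadamard's lemma with a prescribed order of vanishing: by the fundamental theorem of calculus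
  along the segment from \<open>0\<close> to \<open>x\<close>, the quotient is the integral of \<open>\<theta>\<^sup>n * w (\<theta> * x)\<close> over
  \<open>\<theta> \<in> [0, 1]\<close>, which is smooth by the preceding lemma.\<close>

lemma Hadamard_factor:
  fixes u w :: "real \<Rightarrow> real"
  assumes "r > 0" "smooth_on (ball 0 r) w" "u 0 = 0"
    and "\<And>x. x \<in> ball 0 r \<Longrightarrow> (u has_real_derivative x ^ n * w x) (at x)"
  obtains v where "smooth_on (ball 0 r) v" "\<And>x. x \<in> ball 0 r \<Longrightarrow> u x = x ^ Suc n * v x"
    "v 0 = w 0 / Suc n"
proof -
  obtain G where G: "G 0 = w" "\<And>k. smooth_on (ball 0 r) (G k)"
    "\<And>k x. x \<in> ball 0 r \<Longrightarrow> (G k has_real_derivative G (Suc k) x) (at x)"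
    by (rule smooth_on_real_sequenceE[OF assms(2)]) blast
  define V where "V k x = integral {0..1} (\<lambda>\<theta>. \<theta> ^ (n + k) * G k (\<theta> * x))" for k x
  have "(V k has_real_derivative V (Suc k) x) (at x)" if "x \<in> ball 0 r" for k x
    unfolding V_def using scaled_average_has_derivative[OF G(2) that G(3) G(2), of "n + k" k] by simp
  then have sm: "smooth_on (ball 0 r) (V 0)"
    by (rule smooth_on_real_sequenceI[OF open_ball])
  have "u x = x ^ Suc n * V 0 x" if x: "x \<in> ball 0 r" for x
  proof -
    have "((\<lambda>\<theta>. x ^ Suc n * (\<theta> ^ n * w (\<theta> * x))) has_integral u (1 * x) - u (0 * x)) {0..1}"
    proof (rule fundamental_theorem_of_calculus)
      fix \<theta> :: real assume th: "\<theta> \<in> {0..1}"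
      then have "\<theta> * x \<in> ball 0 r"
        using x mult_left_le_one_le[of "\<bar>x\<bar>" \<theta>] by (simp add: abs_mult)
      then have "((\<lambda>\<theta>. u (\<theta> * x)) has_real_derivative (\<theta> * x) ^ n * w (\<theta> * x) * x) (at \<theta> within {0..1})"
        by (intro DERIV_chain2[OF assms(4)]) (auto intro!: derivative_eq_intros)
      then show "((\<lambda>\<theta>. u (\<theta> * x)) has_vector_derivative x ^ Suc n * (\<theta> ^ n * w (\<theta> * x))) (at \<theta> within {0..1})"
        by (simp add: has_real_derivative_iff_has_vector_derivative power_mult_distrib mult_ac)
    qed simp
    then show ?thesis
      by (simp add: V_def G(1) assms(3) has_integral_iff flip: integral_mult_right)
  qed
  moreover have "V 0 0 = w 0 / Suc n"
  proof -
    have "((\<lambda>\<theta>::real. \<theta> ^ n) has_integral 1 ^ Suc n / Suc n - 0 ^ Suc n / Suc n) {0..1}"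
      using DERIV_cdivide[OF DERIV_pow[of "Suc n"], of "real (Suc n)"]
      by (intro fundamental_theorem_of_calculus)
        (auto simp flip: has_real_derivative_iff_has_vector_derivative simp del: power_Suc)
    then show ?thesis by (simp add: V_def G(1) has_integral_iff)
  qed
  ultimately show thesis using sm by (intro that[of "V 0"])
qed

text \<open>Building blocks for Borel's theorem: functions with bounded derivatives and a zero of exact order
  \<open>n\<close> at the origin.  Since \<open>tanh' = 1 - tanh\<^sup>2\<close>, all derivatives of a power of \<open>tanh\<close> are polynomials
  in \<open>tanh\<close>, and each differentiation lowers the order of the zero by exactly one; boundedness of
  \<open>tanh\<close> bounds them.\<close>

lemma tanh_power_derivatives:
  obtains S :: "nat \<Rightarrow> real \<Rightarrow> real" where
    "\<And>k x. (S k has_real_derivative S (Suc k) x) (at x)" "\<And>k. \<exists>B. \<forall>x. \<bar>S k x\<bar> \<le> B"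
    "\<And>k. k < n \<Longrightarrow> S k 0 = 0" "S n 0 \<noteq> 0"
proof -
  define p :: "nat \<Rightarrow> real poly" where
    "p = rec_nat (monom 1 n) (\<lambda>_ q. pderiv q * [:1, 0, -1:])"
  have p_simps: "p 0 = monom 1 n" "\<And>k. p (Suc k) = pderiv (p k) * [:1, 0, -1:]"
    by (auto simp: p_def)
  define S where "S k x = poly (p k) (tanh x)" for k x
  have "(S k has_real_derivative S (Suc k) x) (at x)" for k x
    unfolding S_def p_simps
    by (auto intro!: derivative_eq_intros DERIV_chain2[OF poly_DERIV] simp: power2_eq_square algebra_simps)
  moreover have "\<exists>B. \<forall>x. \<bar>S k x\<bar> \<le> B" for k
  proof -
    have "bounded (poly (p k) ` {-1..1})"
      by (intro compact_imp_bounded compact_continuous_image continuous_intros) auto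
    then obtain B where "\<forall>y\<in>{-1..1}. \<bar>poly (p k) y\<bar> \<le> B"
      unfolding bounded_iff by auto
    then show ?thesis using tanh_real_bounds
      by (intro exI[of _ B]) (auto simp: S_def less_imp_le)
  qed
  moreover have *: "\<exists>q. p k = monom 1 (n - k) * q \<and> poly q 0 \<noteq> 0" if "k \<le> n" for k
    using that
  proof (induction k)
    case 0
    then show ?case by (intro exI[of _ 1]) (simp add: p_simps)
  next
    case (Suc k)
    then obtain q where q: "p k = monom 1 (n - k) * q" "poly q 0 \<noteq> 0" by auto
    have e: "n - k = Suc (n - Suc k)" using Suc.prems by simp
    define M where "M = (monom 1 (n - Suc k) :: real poly)"
    have M: "monom 1 (n - k) = monom 1 1 * M" "pderiv (monom 1 (n - k)) = smult (of_nat (n - k)) M"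
      unfolding e M_def by (simp_all add: mult_monom pderiv_monom smult_monom)
    have "p (Suc k) = M * ((smult (of_nat (n - k)) q + monom 1 1 * pderiv q) * [:1, 0, -1:])"
      unfolding p_simps q(1) pderiv_mult M(2) unfolding M(1) by (simp only: algebra_simps mult_smult_left mult_smult_right)
    moreover have "poly ((smult (of_nat (n - k)) q + monom 1 1 * pderiv q) * [:1, 0, -1:]) 0 \<noteq> 0"
      using q(2) e by (simp add: poly_monom)
    ultimately show ?case unfolding M_def by blast
  qed
  moreover have "S k 0 = 0" if "k < n" for k
    using *[of k] that by (auto simp: S_def poly_monom zero_power)
  moreover have "S n 0 \<noteq> 0"
    using *[of n] by (auto simp: S_def poly_monom)
  ultimately show thesis by (intro that[of S]) auto
qed

text \<open>Rescaling \<open>\<epsilon>\<^sup>n S (x / \<epsilon>)\<close> keeps the \<open>n\<close>-th derivative at the origin and multiplies the \<open>k\<close>-th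
  derivative by \<open>\<epsilon>\<close> to the power \<open>n - k\<close>, which makes the lower ones as small as desired.\<close>

lemma small_derivatives_with_prescribed_nth:
  fixes \<beta> :: real
  shows "\<exists>T :: nat \<Rightarrow> real \<Rightarrow> real. (\<forall>k x. (T k has_real_derivative T (Suc k) x) (at x)) \<and>
    (\<forall>k<n. \<forall>x. \<bar>T k x\<bar> \<le> (1/2) ^ n) \<and> (\<forall>k<n. T k 0 = 0) \<and> T n 0 = \<beta>"
proof -
  obtain S :: "nat \<Rightarrow> real \<Rightarrow> real" where S: "\<And>k x. (S k has_real_derivative S (Suc k) x) (at x)"
    "\<And>k. \<exists>B. \<forall>x. \<bar>S k x\<bar> \<le> B" "\<And>k. k < n \<Longrightarrow> S k 0 = 0" "S n 0 \<noteq> 0"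
    using tanh_power_derivatives[of n] by blast
  obtain B where B: "\<And>k x. \<bar>S k x\<bar> \<le> B k" using S(2) by metis
  have B0: "B k \<ge> 0" for k using B[of k 0] by simp
  define b where "b = \<beta> / S n 0"
  \<comment> \<open>The summand \<open>1\<close> keeps \<open>C\<close> positive and \<open>\<epsilon>\<close> at most \<open>1\<close>.\<close>
  define C where "C = 1 + \<bar>b\<bar> * (\<Sum>k<n. B k)"
  have C: "C \<ge> 1" using B0 by (simp add: C_def sum_nonneg)
  define \<epsilon> where "\<epsilon> = (1/2) ^ n / C"
  have \<epsilon>: "0 < \<epsilon>" "\<epsilon> \<le> 1"
    using C power_le_one[of "1/2::real" n] by (auto simp: \<epsilon>_def divide_le_eq)
  define T where "T k x = b * \<epsilon> ^ n / \<epsilon> ^ k * S k (x / \<epsilon>)" for k x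
  have "(T k has_real_derivative T (Suc k) x) (at x)" for k x
    unfolding T_def using \<epsilon>
    by (auto intro!: derivative_eq_intros DERIV_chain2[OF S(1)])
  moreover have "\<bar>T k x\<bar> \<le> (1/2) ^ n" if "k < n" for k x
  proof -
    have "\<epsilon> ^ n / \<epsilon> ^ k = \<epsilon> ^ (n - k)" using that \<epsilon> by (simp add: power_diff)
    also have "\<dots> \<le> \<epsilon>" using power_decreasing[of 1 "n - k" \<epsilon>] that \<epsilon> by simp
    finally have 1: "\<epsilon> ^ n / \<epsilon> ^ k \<le> \<epsilon>" .
    have "\<bar>T k x\<bar> = (\<epsilon> ^ n / \<epsilon> ^ k) * (\<bar>b\<bar> * \<bar>S k (x / \<epsilon>)\<bar>)"
      using \<epsilon> by (simp add: T_def abs_mult)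
    also have "\<dots> \<le> \<epsilon> * (\<bar>b\<bar> * B k)"
      using 1 B \<epsilon> by (intro mult_mono) (auto intro: mult_left_mono)
    also have "\<dots> \<le> \<epsilon> * C"
    proof (rule mult_left_mono)
      have "B k \<le> (\<Sum>k<n. B k)" using that B0 by (intro member_le_sum) auto
      from mult_left_mono[OF this abs_ge_zero[of b]]
      show "\<bar>b\<bar> * B k \<le> C" by (simp add: C_def)
    qed (use \<epsilon> in simp)
    also have "\<dots> = (1/2) ^ n" using C by (simp add: \<epsilon>_def)
    finally show ?thesis .
  qed
  moreover have "T k 0 = 0" if "k < n" for k using S(3)[OF that] by (simp add: T_def)
  moreover have "T n 0 = \<beta>" using S(4) \<epsilon> by (simp add: T_def b_def)
  ultimately show ?thesis by blast
qed

text \<open>Borel's theorem: every sequence is the sequence of derivatives at \<open>0\<close> of a smooth function.  The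
  function is a series whose \<open>n\<close>-th term corrects the \<open>n\<close>-th derivative left by its predecessors and
  does not disturb the earlier ones.  The \<open>k\<close>-th derivatives of the terms with \<open>n > k\<close> are dominated
  by a geometric series, so that termwise differentiation is justified.\<close>

lemma Borel_realization:
  fixes c :: "nat \<Rightarrow> real"
  obtains f :: "nat \<Rightarrow> real \<Rightarrow> real" where
    "\<And>k x. (f k has_real_derivative f (Suc k) x) (at x)" "\<And>k. f k 0 = c k"
proof -
  obtain H :: "nat \<Rightarrow> real \<Rightarrow> nat \<Rightarrow> real \<Rightarrow> real" where
    H: "\<And>n \<beta> k x. (H n \<beta> k has_real_derivative H n \<beta> (Suc k) x) (at x)"
      "\<And>n \<beta> k x. k < n \<Longrightarrow> \<bar>H n \<beta> k x\<bar> \<le> (1/2) ^ n"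
      "\<And>n \<beta> k. k < n \<Longrightarrow> H n \<beta> k 0 = 0" "\<And>n \<beta>. H n \<beta> n 0 = \<beta>"
    using small_derivatives_with_prescribed_nth by metis
  \<comment> \<open>\<open>P n k\<close> is the \<open>k\<close>-th derivative of the \<open>n\<close>-th partial sum; the recursion runs over partial sums
    because the next term depends on all preceding ones.\<close>
  define P :: "nat \<Rightarrow> nat \<Rightarrow> real \<Rightarrow> real" where
    "P = rec_nat (\<lambda>_ _. 0) (\<lambda>n p k x. p k x + H n (c n - p n 0) k x)"
  define T where "T n = H n (c n - P n n 0)" for n
  have P: "P n k x = (\<Sum>m<n. T m k x)" for n k x
    by (induction n) (auto simp: P_def T_def)
  have T_bd: "\<forall>\<^sub>F n in sequentially. \<forall>x\<in>UNIV. norm (T n k x) \<le> (1/2) ^ n" for k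
    using eventually_gt_at_top[of k] by eventually_elim (auto simp: T_def H(2))
  have unif: "uniform_limit UNIV (\<lambda>n x. \<Sum>i<n. T i k x) (\<lambda>x. \<Sum>i. T i k x) sequentially" for k
    by (rule Weierstrass_m_test_ev[OF T_bd]) (simp add: summable_geometric)
  have summ: "summable (\<lambda>n. T n k x)" for k x
    using tendsto_uniform_limitI[OF unif, of x k] by (auto simp: summable_def sums_def)
  define f where "f k x = (\<Sum>n. T n k x)" for k x
  have "(f k has_real_derivative f (Suc k) x) (at x)" for k x
    unfolding f_def
    by (rule has_field_derivative_series'(2)[where f = "\<lambda>n. T n k" and f' = "\<lambda>n. T n (Suc k)" and S = UNIV and ?x0.0 = 0])
      (use unif[of "Suc k"] summ H(1) in \<open>auto simp: uniformly_convergent_on_def T_def\<close>)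
  moreover have "f k 0 = c k" for k
  proof -
    have "f k 0 = (\<Sum>n<Suc k. T n k 0)"
      unfolding f_def by (rule suminf_finite) (auto simp: T_def H(3))
    also have "\<dots> = P k k 0 + T k k 0" by (simp add: P)
    also have "\<dots> = c k" by (simp add: T_def H(4))
    finally show ?thesis .
  qed
  ultimately show thesis by (rule that)
qed

text \<open>The derivative of an even function is odd, hence divisible by \<open>x\<close>, and the quotient is even
  again.  In terms of \<open>g\<close> with \<open>h x = g (x\<^sup>2)\<close> the quotient \<open>k\<close> is \<open>g' (x\<^sup>2)\<close>, so iterating gives all
  derivatives of \<open>g\<close>.\<close>

lemma even_derivative_factor:
  fixes h :: "real \<Rightarrow> real"
  assumes "r > 0" "smooth_on (ball 0 r) h" "\<And>x. x \<in> ball 0 r \<Longrightarrow> h (- x) = h x"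
  obtains k where "smooth_on (ball 0 r) k" "\<And>x. x \<in> ball 0 r \<Longrightarrow> k (- x) = k x"
    "\<And>x. x \<in> ball 0 r \<Longrightarrow> (h has_real_derivative x * (2 * k x)) (at x)"
proof -
  obtain h' where h': "smooth_on (ball 0 r) h'"
    "\<And>x. x \<in> ball 0 r \<Longrightarrow> (h has_real_derivative h' x) (at x)"
    using smooth_on_realE[OF assms(2)] by blast
  obtain h'' where h'': "smooth_on (ball 0 r) h''"
    "\<And>x. x \<in> ball 0 r \<Longrightarrow> (h' has_real_derivative h'' x) (at x)"
    using smooth_on_realE[OF h'(1)] by blast
  have odd: "h' (- x) = - h' x" if x: "x \<in> ball 0 r" for x
  proof -
    have "((\<lambda>x. h (- x)) has_real_derivative h' (- x) * (- 1)) (at x)"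
      using x by (intro DERIV_chain2[OF h'(2)]) (auto intro!: derivative_eq_intros)
    then have "(h has_real_derivative h' (- x) * (- 1)) (at x)"
      by (rule has_field_derivative_transform_within_open[OF _ open_ball x assms(3)])
    then show ?thesis using DERIV_unique h'(2)[OF x] by fastforce
  qed
  have "h' 0 = 0" using odd[of 0] assms(1) by simp
  then obtain v where v: "smooth_on (ball 0 r) v" "\<And>x. x \<in> ball 0 r \<Longrightarrow> h' x = x * v x"
    using Hadamard_factor[OF assms(1) h''(1), where u = h' and n = 0] h''(2)
    by (metis mult_1 power_0 power_Suc0_right One_nat_def)
  have "v (- x) = v x" if "x \<in> ball 0 r" for x
    using odd[OF that] v(2)[OF that] v(2)[of "-x"] that by (cases "x = 0") auto
  moreover have "smooth_on (ball 0 r) (\<lambda>x. v x * (1 / 2))"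
    by (intro smooth_on_mult v smooth_on_const open_ball)
  ultimately show thesis
    using h'(2) v(2) by (intro that[of "\<lambda>x. v x * (1 / 2)"]) simp_all
qed

text \<open>Whitney's theorem on even functions.  On \<open>x \<ge> 0\<close> the function \<open>g\<close> and its derivatives must be
  \<open>H k (sqrt x)\<close> for the iterated quotients \<open>H k\<close> of the preceding lemma.  To the left of the origin
  the values of \<open>h\<close> impose nothing except the Taylor coefficients at \<open>0\<close>, so a function provided by
  Borel's theorem is glued on there.\<close>

lemma even_smooth_is_smooth_of_square:
  fixes h :: "real \<Rightarrow> real"
  assumes r: "r > 0" and "smooth_on (ball 0 r) h" "\<And>x. x \<in> ball 0 r \<Longrightarrow> h (- x) = h x"
  obtains g where "smooth_on (ball 0 (r\<^sup>2)) g" "\<And>x. x \<in> ball 0 r \<Longrightarrow> h x = g (x\<^sup>2)"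
proof -
  let ?P = "\<lambda>h. smooth_on (ball 0 r) h \<and> (\<forall>x\<in>ball 0 r. h (- x) = h x)"
  let ?Q = "\<lambda>h k. \<forall>x\<in>ball 0 r. (h has_real_derivative x * (2 * k x)) (at x)"
  have "\<forall>h. ?P h \<longrightarrow> (\<exists>k. ?P k \<and> ?Q h k)"
    using even_derivative_factor[OF r] by metis
  then obtain d where d: "\<And>h. ?P h \<Longrightarrow> ?P (d h) \<and> ?Q h (d h)" by metis
  define H where "H k = (d ^^ k) h" for k
  have P: "?P (H k)" for k
    by (induction k) (use assms d in \<open>auto simp: H_def\<close>)
  have Q: "(H k has_real_derivative x * (2 * H (Suc k) x)) (at x)" if "x \<in> ball 0 r" for k x
    using d[OF P[of k]] that by (simp add: H_def)
  obtain f :: "nat \<Rightarrow> real \<Rightarrow> real" where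
    f: "\<And>k x. (f k has_real_derivative f (Suc k) x) (at x)" "\<And>k. f k 0 = H k 0"
    using Borel_realization[of "\<lambda>k. H k 0"] by blast
  define G where "G k x = (if x \<ge> 0 then H k (sqrt x) else f k x)" for k x
  have G: "(G k has_real_derivative G (Suc k) x) (at x)" if x: "x \<in> ball 0 (r\<^sup>2)" for k x
  proof -
    consider "x > 0" | "x < 0" | "x = 0" by linarith
    then show ?thesis
    proof cases
      case 1
      have "sqrt x < r" using x r by (intro real_less_lsqrt) auto
      then have "((\<lambda>x. H k (sqrt x)) has_real_derivative
          (sqrt x * (2 * H (Suc k) (sqrt x))) * (inverse (sqrt x) / 2)) (at x)"
        using 1 by (intro DERIV_chain2[OF Q] DERIV_real_sqrt) auto
      then have "((\<lambda>x. H k (sqrt x)) has_real_derivative G (Suc k) x) (at x)"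
        using 1 by (simp add: G_def field_simps)
      then show ?thesis
        by (rule has_field_derivative_transform_within_open[where S = "{0<..}"])
          (use 1 in \<open>auto simp: G_def\<close>)
    next
      case 2
      then have "(f k has_real_derivative G (Suc k) x) (at x)" using f(1) by (simp add: G_def)
      then show ?thesis
        by (rule has_field_derivative_transform_within_open[where S = "{..<0}"])
          (use 2 in \<open>auto simp: G_def\<close>)
    next
      case 3
      \<comment> \<open>From the right, the difference quotient at \<open>y\<close> is \<open>v (sqrt y)\<close>, where \<open>H k x - H k 0 = x\<^sup>2 * v x\<close>.\<close>
      have "smooth_on (ball 0 r) (\<lambda>x. 2 * H (Suc k) x)"
        using P[of "Suc k"] by (intro smooth_on_intros) auto
      moreover have "((\<lambda>x. H k x - H k 0) has_real_derivative x ^ 1 * (2 * H (Suc k) x)) (at x)"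
        if "x \<in> ball 0 r" for x
        using DERIV_diff[OF Q[OF that] DERIV_const] by simp
      ultimately obtain v where v: "smooth_on (ball 0 r) v" "v 0 = 2 * H (Suc k) 0 / Suc 1"
        "\<And>x. x \<in> ball 0 r \<Longrightarrow> H k x - H k 0 = x ^ Suc 1 * v x"
        using Hadamard_factor[OF r, of "\<lambda>x. 2 * H (Suc k) x" "\<lambda>x. H k x - H k 0" 1]
        by (metis (no_types, lifting) diff_self)
      have "((\<lambda>y. v (sqrt y)) \<longlongrightarrow> v (sqrt 0)) (at_right 0)"
      proof (rule isCont_tendsto_compose[where g = v and f = sqrt and l = "sqrt 0"])
        have "continuous_on (ball 0 r) v" using v(1) by (rule smooth_on_imp_continuous_on)
        then show "isCont v (sqrt 0)"
          using r by (simp add: continuous_on_eq_continuous_at)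
      qed (auto intro!: tendsto_eq_intros)
      moreover have "\<forall>\<^sub>F y in at_right 0. v (sqrt y) = (G k y - G k 0) / (y - 0)"
      proof -
        have "\<forall>\<^sub>F y in at_right 0. y \<in> {0<..<r\<^sup>2}"
          using r by (intro eventually_at_right_real) auto
        then show ?thesis
        proof eventually_elim
          case (elim y)
          then have "sqrt y < r" using r by (intro real_less_lsqrt) auto
          then show ?case using v(3)[of "sqrt y"] elim by (simp add: G_def)
        qed
      qed
      ultimately have "((\<lambda>y. (G k y - G k 0) / (y - 0)) \<longlongrightarrow> v (sqrt 0)) (at_right 0)"
        by (rule Lim_transform_eventually)
      then have right: "((\<lambda>y. (G k y - G k 0) / (y - 0)) \<longlongrightarrow> G (Suc k) 0) (at_right 0)"
        by (simp add: G_def v)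
      have "((\<lambda>y. (f k y - f k 0) / (y - 0)) \<longlongrightarrow> f (Suc k) 0) (at_left 0)"
        using f(1)[of k 0] unfolding has_field_derivative_iff by (rule filterlim_mono) (auto simp: at_le)
      moreover have "\<forall>\<^sub>F y in at_left 0. (f k y - f k 0) / (y - 0) = (G k y - G k 0) / (y - 0)"
      proof -
        have "\<forall>\<^sub>F y in at_left 0. y \<in> {- 1 :: real <..<0}"
          by (rule eventually_at_left_real) simp
        then show ?thesis by eventually_elim (auto simp: G_def f(2))
      qed
      ultimately have left: "((\<lambda>y. (G k y - G k 0) / (y - 0)) \<longlongrightarrow> G (Suc k) 0) (at_left 0)"
        using Lim_transform_eventually by (fastforce simp: G_def f(2))
      show ?thesis
        unfolding has_field_derivative_iff 3 by (rule filterlim_split_at[OF left right])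
    qed
  qed
  have "smooth_on (ball 0 (r\<^sup>2)) (G 0)"
    by (rule smooth_on_real_sequenceI[where G = G and n = 0, OF open_ball G])
  moreover have "h x = G 0 (x\<^sup>2)" if "x \<in> ball 0 r" for x
    using assms(3)[OF that] by (simp add: G_def H_def abs_if)
  ultimately show thesis by (rule that)
qed

lemma even_odd_decomposition:
  fixes h :: "real \<Rightarrow> real"
  assumes r: "r > 0" and h: "smooth_on (ball 0 r) h"
  obtains \<alpha> \<beta> where "smooth_on (ball 0 (r\<^sup>2)) \<alpha>" "smooth_on (ball 0 (r\<^sup>2)) \<beta>"
    "\<And>x. x \<in> ball 0 r \<Longrightarrow> h x = \<alpha> (x\<^sup>2) + x * \<beta> (x\<^sup>2)"
proof -
  have hm: "smooth_on (ball 0 r) (\<lambda>x. h (- x))"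
    by (rule smooth_on_compose[OF _ _ _ h])
      (auto intro!: smooth_on_bounded_linear bounded_linear_minus bounded_linear_ident)
  define e where "e = (\<lambda>x. (h x + h (- x)) * (1 / 2))"
  define d where "d = (\<lambda>x. (h x - h (- x)) * (1 / 2))"
  have sm: "smooth_on (ball 0 r) e" "smooth_on (ball 0 r) d"
    unfolding e_def d_def by (intro smooth_on_intros h hm open_ball)+
  obtain \<alpha> where \<alpha>: "smooth_on (ball 0 (r\<^sup>2)) \<alpha>" "\<And>x. x \<in> ball 0 r \<Longrightarrow> e x = \<alpha> (x\<^sup>2)"
    by (rule even_smooth_is_smooth_of_square[OF r sm(1)]) (auto simp: e_def)
  obtain d' where d': "smooth_on (ball 0 r) d'"
    "\<And>x. x \<in> ball 0 r \<Longrightarrow> (d has_real_derivative d' x) (at x)"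
    using smooth_on_realE[OF sm(2)] by blast
  have "d 0 = 0" by (simp add: d_def)
  then obtain k where k: "smooth_on (ball 0 r) k" "\<And>x. x \<in> ball 0 r \<Longrightarrow> d x = x * k x"
    using Hadamard_factor[OF r d'(1), where u = d and n = 0] d'(2)
    by (metis mult_1 power_0 power_Suc0_right One_nat_def)
  have "k (- x) = k x" if "x \<in> ball 0 r" for x
  proof -
    have "d (- x) = - d x" unfolding d_def minus_minus by (metis minus_diff_eq minus_mult_left)
    then show ?thesis using k(2)[OF that] k(2)[of "- x"] that by (cases "x = 0") auto
  qed
  then obtain \<beta> where \<beta>: "smooth_on (ball 0 (r\<^sup>2)) \<beta>" "\<And>x. x \<in> ball 0 r \<Longrightarrow> k x = \<beta> (x\<^sup>2)"
    using even_smooth_is_smooth_of_square[OF r k(1)] by blast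
  have "h x = \<alpha> (x\<^sup>2) + x * \<beta> (x\<^sup>2)" if "x \<in> ball 0 r" for x
  proof -
    have "h x = e x + d x" by (simp add: e_def d_def field_simps)
    then show ?thesis using \<alpha>(2)[OF that] \<beta>(2)[OF that] k(2)[OF that] by simp
  qed
  with \<alpha>(1) \<beta>(1) show thesis by (rule that)
qed


section \<open>Semicubic cusps\<close>

text \<open>The inverse function solves the differential equation \<open>T' = 1 / s' (T)\<close>, so existence and
  smoothness are instances of the theorems on integral curves.\<close>

lemma smooth_local_inverse:
  fixes s s' :: "real \<Rightarrow> real"
  assumes r: "r > 0" and s': "smooth_on (ball 0 r) s'" "\<And>x. x \<in> ball 0 r \<Longrightarrow> s' x > 0"
    and s: "\<And>x. x \<in> ball 0 r \<Longrightarrow> (s has_real_derivative s' x) (at x)" "s 0 = 0"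
  obtains \<eta> T where "\<eta> > 0" "smooth_on (ball 0 \<eta>) T" "T 0 = 0"
    "\<And>y. y \<in> ball 0 \<eta> \<Longrightarrow> T y \<in> ball 0 r" "\<And>y. y \<in> ball 0 \<eta> \<Longrightarrow> s (T y) = y"
    "\<And>x. x \<in> ball 0 r \<Longrightarrow> s x \<in> ball 0 \<eta> \<Longrightarrow> T (s x) = x"
proof -
  have sm: "smooth_on (ball 0 r) (\<lambda>x. 1 / s' x)"
    using s'(2) by (intro smooth_on_divide smooth_on_const s' open_ball) fastforce
  obtain J T where J: "0 \<in> J" "integral_curve (ball 0 r) (\<lambda>x. 1 / s' x) J T" "T 0 = 0"
    by (rule integral_curve_exists[of "ball 0 r" "\<lambda>x. 1 / s' x" 0])
      (use sm r in \<open>auto simp: smooth_on_def simp del: Ck_on.simps\<close>)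
  have "open J" using J(2) by (simp add: integral_curve_def)
  then obtain \<eta> where \<eta>: "\<eta> > 0" "ball 0 \<eta> \<subseteq> J" using J(1) open_contains_ball by blast
  have T_in: "T y \<in> ball 0 r" if "y \<in> ball 0 \<eta>" for y
    using J(2) \<eta>(2) that unfolding integral_curve_def by blast
  have sT: "s (T y) = y" if y: "y \<in> ball 0 \<eta>" for y
  proof -
    have "((\<lambda>y. s (T y) - y) has_real_derivative 0) (at y within ball 0 \<eta>)" if "y \<in> ball 0 \<eta>" for y
    proof -
      have "(T has_real_derivative 1 / s' (T y)) (at y)"
        using J(2) \<eta>(2) that unfolding integral_curve_def has_real_derivative_iff_has_vector_derivative
        by blast
      from DERIV_chain2[OF s(1)[OF T_in[OF that]] this]
      have "((\<lambda>y. s (T y)) has_real_derivative 1) (at y)"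
        using s'(2)[OF T_in[OF that]] by simp
      then have "((\<lambda>y. s (T y) - y) has_real_derivative 1 - 1) (at y)"
        by (intro derivative_intros)
      then show ?thesis by (simp add: has_field_derivative_at_within)
    qed
    then have "\<exists>c. \<forall>y\<in>ball 0 \<eta>. s (T y) - y = c"
      by (intro has_field_derivative_zero_constant) auto
    then have "s (T y) - y = s (T 0) - 0" using y \<eta>(1) by (metis centre_in_ball)
    then show ?thesis using J(3) s(2) by simp
  qed
  have inj: "x = y" if "x \<in> ball 0 r" "y \<in> ball 0 r" "s x = s y" for x y
  proof (rule ccontr)
    have less: "s a < s b" if "a \<in> ball 0 r" "b \<in> ball 0 r" "a < b" for a b
    proof (rule DERIV_pos_imp_increasing[OF that(3)])
      fix x assume "a \<le> x" "x \<le> b"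
      then have "x \<in> ball 0 r" using that by auto
      then show "\<exists>y. (s has_real_derivative y) (at x) \<and> 0 < y" using s(1) s'(2) by blast
    qed
    assume "x \<noteq> y"
    then show False using less[of x y] less[of y x] that by linarith
  qed
  have "T (s x) = x" if "x \<in> ball 0 r" "s x \<in> ball 0 \<eta>" for x
    using inj[OF T_in[OF that(2)] that(1)] sT[OF that(2)] .
  moreover have "smooth_on (ball 0 \<eta>) T"
    by (rule smooth_on_subset[OF integral_curve_smooth[OF open_ball sm J(2)] \<eta>(2)])
  ultimately show thesis using \<eta>(1) J(3) T_in sT by (intro that)
qed

lemma diffeo_onI:
  assumes "open N" "open N'" "smooth_on N \<Phi>" "smooth_on N' \<Psi>"
    and "\<And>z. z \<in> N \<Longrightarrow> \<Phi> z \<in> N'" "\<And>w. w \<in> N' \<Longrightarrow> \<Psi> w \<in> N"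
    and "\<And>z. z \<in> N \<Longrightarrow> \<Psi> (\<Phi> z) = z" "\<And>w. w \<in> N' \<Longrightarrow> \<Phi> (\<Psi> w) = w"
  shows "diffeo_on N \<Phi>" "\<Phi> ` N = N'"
proof -
  show im: "\<Phi> ` N = N'" using assms(5,6,8) by (metis image_subsetI rev_image_eqI subsetI subset_antisym)
  have inj: "inj_on \<Phi> N" using assms(7) by (rule inj_on_inverseI)
  have "smooth_on N' (inv_into N \<Phi>)"
    by (rule smooth_on_cong[OF assms(2) _ assms(4)])
      (metis assms(6,8) inj inv_into_f_f)
  then show "diffeo_on N \<Phi>"
    unfolding diffeo_on_def im using assms(1-3) inj by blast
qed

text \<open>The normal form of the cusp.  With \<open>\<epsilon>\<close> the sign of \<open>f 0\<close>, the parameter \<open>s = \<tau> * sqrt (\<epsilon> * f \<tau>)\<close>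
  makes \<open>X = \<epsilon> * (x - x\<^sub>0)\<close> equal to \<open>s\<^sup>2\<close>, and the other coordinate (after the shear that removes the
  slope \<open>m\<close>) becomes \<open>s\<^sup>3 * h s\<close> with \<open>h 0 \<noteq> 0\<close>.  Splitting \<open>h\<close> into its even and odd parts turns this into
  \<open>s\<^sup>3 * \<alpha> X + X\<^sup>2 * \<beta> X\<close> with smooth \<open>\<alpha>\<close> and \<open>\<beta>\<close>.  Solving for \<open>s\<^sup>3\<close>, that is subtracting
  \<open>X\<^sup>2 * \<beta> X\<close> and dividing by \<open>\<alpha> X\<close>, is a diffeomorphism of a vertical strip and straightens the curve
  to \<open>(s\<^sup>2, s\<^sup>3)\<close>.\<close>

lemma semicubic_at_of_factorization:
  fixes \<gamma> :: "real \<Rightarrow> real \<times> real"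
  assumes J: "open J" "t0 \<in> J" and r: "r > 0"
    and f: "smooth_on (ball 0 r) f" "f 0 \<noteq> 0" and g: "smooth_on (ball 0 r) g" "g 0 \<noteq> 0"
    and x: "\<And>\<tau>. \<tau> \<in> ball 0 r \<Longrightarrow> fst (\<gamma> (t0 + \<tau>)) - fst (\<gamma> t0) = \<tau> ^ 2 * f \<tau>"
    and y: "\<And>\<tau>. \<tau> \<in> ball 0 r \<Longrightarrow> snd (\<gamma> (t0 + \<tau>)) - snd (\<gamma> t0)
      - m * (fst (\<gamma> (t0 + \<tau>)) - fst (\<gamma> t0)) = \<tau> ^ 3 * g \<tau>"
  shows "semicubic_at J t0 \<gamma>"
proof -
  obtain x0 y0 where q: "\<gamma> t0 = (x0, y0)" by fastforce
  define \<epsilon> where "\<epsilon> = sgn (f 0)"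
  have \<epsilon>: "\<epsilon> * \<epsilon> = 1" "\<epsilon> * f 0 > 0" "\<bar>\<epsilon>\<bar> = 1" using f(2) by (auto simp: \<epsilon>_def sgn_if)
  have shrink: "\<exists>r'>0. r' \<le> r \<and> (\<forall>x\<in>ball 0 r'. u x > 0)"
    if "continuous_on (ball 0 r) u" "u 0 > 0" "r > 0" for r and u :: "real \<Rightarrow> real"
  proof -
    have "open (ball 0 r \<inter> u -` {0<..})"
      using that(1) by (rule continuous_open_preimage) auto
    moreover have "0 \<in> ball 0 r \<inter> u -` {0<..}" using that by auto
    ultimately obtain d where "d > 0" "ball 0 d \<subseteq> ball 0 r \<inter> u -` {0<..}"
      using open_contains_ball by meson
    then show ?thesis by (intro exI[of _ "min d r"]) (use that in auto)
  qed
  have sm_f: "smooth_on (ball 0 r) (\<lambda>\<tau>. \<epsilon> * f \<tau>)"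
    by (intro smooth_on_intros f open_ball)
  obtain r1 where r1: "r1 > 0" "r1 \<le> r" "\<And>\<tau>. \<tau> \<in> ball 0 r1 \<Longrightarrow> \<epsilon> * f \<tau> > 0"
    using shrink[OF smooth_on_imp_continuous_on[OF sm_f] \<epsilon>(2) r] by blast
  define k where "k = (\<lambda>\<tau>. sqrt (\<epsilon> * f \<tau>))"
  have sm_k: "smooth_on (ball 0 r1) k"
    unfolding k_def
    by (rule smooth_on_compose[OF _ _ _ smooth_on_sqrt])
      (use r1 in \<open>auto intro: smooth_on_subset[OF sm_f]\<close>)
  have k_pos: "k \<tau> > 0" and k_sq: "(k \<tau>)\<^sup>2 = \<epsilon> * f \<tau>" if "\<tau> \<in> ball 0 r1" for \<tau>
    using r1(3)[OF that] by (auto simp: k_def)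
  define s where "s = (\<lambda>\<tau>. \<tau> * k \<tau>)"
  have "smooth_on (ball 0 r1) s"
    unfolding s_def
    by (intro smooth_on_mult sm_k open_ball smooth_on_bounded_linear bounded_linear_ident)
  then obtain s' where s': "smooth_on (ball 0 r1) s'"
    "\<And>x. x \<in> ball 0 r1 \<Longrightarrow> (s has_real_derivative s' x) (at x)"
    using smooth_on_realE by blast
  have "s' 0 = k 0"
  proof -
    obtain k' where "\<And>x. x \<in> ball 0 r1 \<Longrightarrow> (k has_real_derivative k' x) (at x)"
      using smooth_on_realE[OF sm_k] by blast
    then have "(k has_real_derivative k' 0) (at 0)" using r1(1) by simp
    then have "(s has_real_derivative k 0) (at 0)"
      unfolding s_def by (auto intro!: derivative_eq_intros)
    then show ?thesis using s'(2)[of 0] r1(1) DERIV_unique by auto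
  qed
  then have "s' 0 > 0" using k_pos r1(1) by simp
  then obtain r2 where r2: "r2 > 0" "r2 \<le> r1" "\<And>\<tau>. \<tau> \<in> ball 0 r2 \<Longrightarrow> s' \<tau> > 0"
    using shrink[OF smooth_on_imp_continuous_on[OF s'(1)] _ r1(1)] by blast
  have sub: "ball 0 r2 \<subseteq> ball 0 r1" "ball 0 r2 \<subseteq> (ball 0 r :: real set)" using r2 r1 by auto
  obtain \<eta>1 T where T: "\<eta>1 > 0" "smooth_on (ball 0 \<eta>1) T" "T 0 = 0"
    "\<And>y. y \<in> ball 0 \<eta>1 \<Longrightarrow> T y \<in> ball 0 r2" "\<And>y. y \<in> ball 0 \<eta>1 \<Longrightarrow> s (T y) = y"
    "\<And>x. x \<in> ball 0 r2 \<Longrightarrow> s x \<in> ball 0 \<eta>1 \<Longrightarrow> T (s x) = x"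
  proof (rule smooth_local_inverse[OF r2(1) smooth_on_subset[OF s'(1) sub(1)] r2(3)])
    show "(s has_real_derivative s' x) (at x)" if "x \<in> ball 0 r2" for x
      using s'(2) sub(1) that by blast
  qed (auto simp: s_def)
  define h where "h = (\<lambda>y. g (T y) / k (T y) ^ 3)"
  have T_im: "T ` ball 0 \<eta>1 \<subseteq> ball 0 r1" "T ` ball 0 \<eta>1 \<subseteq> ball 0 r"
    using T(4) sub by blast+
  have "k (T y) ^ 3 \<noteq> 0" if "y \<in> ball 0 \<eta>1" for y
  proof -
    have "T y \<in> ball 0 r1" using T_im(1) that by blast
    from k_pos[OF this] show ?thesis by simp
  qed
  then have sm_h: "smooth_on (ball 0 \<eta>1) h"
    unfolding h_def
    by (intro smooth_on_divide smooth_on_power smooth_on_compose[OF _ _ T(2) g(1)]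
        smooth_on_compose[OF _ _ T(2) sm_k] T_im open_ball)
  have cube: "T y ^ 3 * g (T y) = y ^ 3 * h y" if "y \<in> ball 0 \<eta>1" for y
  proof -
    have "k (T y) > 0" using k_pos T(4)[OF that] sub by blast
    moreover have "y = T y * k (T y)" using T(5)[OF that] by (simp add: s_def)
    then have "y ^ 3 = T y ^ 3 * k (T y) ^ 3" by (metis power_mult_distrib)
    ultimately show ?thesis by (simp add: h_def)
  qed
  obtain \<alpha> \<beta> where ab: "smooth_on (ball 0 (\<eta>1\<^sup>2)) \<alpha>" "smooth_on (ball 0 (\<eta>1\<^sup>2)) \<beta>"
    "\<And>y. y \<in> ball 0 \<eta>1 \<Longrightarrow> h y = \<alpha> (y\<^sup>2) + y * \<beta> (y\<^sup>2)"
    using even_odd_decomposition[OF T(1) sm_h] by blast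
  have "\<alpha> 0 \<noteq> 0"
    using ab(3)[of 0] T(1,3) g(2) k_pos[of 0] r1(1) by (auto simp: h_def)
  \<comment> \<open>The square turns the nonvanishing of \<open>\<alpha>\<close> into a positivity condition, to which \<open>shrink\<close> applies.\<close>
  then have "(\<alpha> 0)\<^sup>2 > 0" by simp
  then obtain d where d: "d > 0" "d \<le> \<eta>1\<^sup>2" "\<And>X. X \<in> ball 0 d \<Longrightarrow> (\<alpha> X)\<^sup>2 > 0"
    using shrink[OF continuous_on_power[OF smooth_on_imp_continuous_on[OF ab(1)]]] T(1)
    by (metis zero_less_power)
  have cusp: "semicubic_cusp (\<gamma> ` (J \<inter> ball t0 e)) (\<gamma> t0)"
    if e: "e > 0" "e < r2" "ball t0 e \<subseteq> J" for e
  proof -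
    have "open (ball 0 \<eta>1 \<inter> T -` ball 0 e)"
      by (rule continuous_open_preimage[OF smooth_on_imp_continuous_on[OF T(2)]]) auto
    moreover have "0 \<in> ball 0 \<eta>1 \<inter> T -` ball 0 e" using T e by auto
    ultimately obtain \<eta>2 where \<eta>2: "\<eta>2 > 0" "ball 0 \<eta>2 \<subseteq> ball 0 \<eta>1 \<inter> T -` ball 0 e"
      using open_contains_ball by meson
    define \<eta> where "\<eta> = min \<eta>2 (sqrt d)"
    have \<eta>: "\<eta> > 0" "ball 0 \<eta> \<subseteq> (ball 0 \<eta>1 :: real set)" "\<And>y. y \<in> ball 0 \<eta> \<Longrightarrow> T y \<in> ball 0 e"
      using \<eta>2 d(1) by (auto simp: \<eta>_def)
    have "\<eta>\<^sup>2 \<le> d"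
      using \<eta>(1) d(1) power_mono[of \<eta> "sqrt d" 2] by (simp add: \<eta>_def)
    then have bd: "ball 0 (\<eta>\<^sup>2) \<subseteq> (ball 0 d :: real set)" "ball 0 (\<eta>\<^sup>2) \<subseteq> (ball 0 (\<eta>1\<^sup>2) :: real set)"
      using d(2) by auto
    have \<alpha>_nz: "\<alpha> X \<noteq> 0" if "X \<in> ball 0 (\<eta>\<^sup>2)" for X
      using d(3)[of X] bd(1) that by auto
    define \<Phi> where "\<Phi> = (\<lambda>z::real\<times>real. let X = \<epsilon> * (fst z - x0) in
      (X, (snd z - y0 - m * (fst z - x0) - X\<^sup>2 * \<beta> X) / \<alpha> X))"
    define \<Psi> where "\<Psi> = (\<lambda>w::real\<times>real. (x0 + \<epsilon> * fst w,
      y0 + m * (\<epsilon> * fst w) + (fst w)\<^sup>2 * \<beta> (fst w) + snd w * \<alpha> (fst w)))"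
    \<comment> \<open>The strip is so narrow that, within it, the arc consists of the points with \<open>\<bar>s\<bar> < \<eta>\<close>, all of
      which have parameters in the given ball.\<close>
    define N where "N = {z :: real \<times> real. \<epsilon> * (fst z - x0) \<in> ball 0 (\<eta>\<^sup>2)}"
    define N' where "N' = {w :: real \<times> real. fst w \<in> ball 0 (\<eta>\<^sup>2)}"
    have N': "N' = ball 0 (\<eta>\<^sup>2) \<times> UNIV" by (auto simp: N'_def)
    have "N = (\<lambda>z. \<epsilon> * (fst z - x0)) -` ball 0 (\<eta>\<^sup>2)" by (auto simp: N_def)
    moreover have "open \<dots>"
      by (intro open_vimage continuous_intros open_ball)
    ultimately have op: "open N" "open N'" by (auto simp: N' intro: open_Times)
    have lin: "smooth_on N fst" "smooth_on N snd" "smooth_on N' fst" "smooth_on N' snd"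
      using op by (auto intro: smooth_on_bounded_linear bounded_linear_fst bounded_linear_snd)
    have smX: "smooth_on N (\<lambda>z. \<epsilon> * (fst z - x0))"
      by (intro smooth_on_intros lin op)
    have smab: "smooth_on N (\<lambda>z. \<alpha> (\<epsilon> * (fst z - x0)))" "smooth_on N (\<lambda>z. \<beta> (\<epsilon> * (fst z - x0)))"
      by (rule smooth_on_compose[OF op(1) _ smX ab(1)] smooth_on_compose[OF op(1) _ smX ab(2)];
          use bd(2) in \<open>auto simp: N_def\<close>)+
    have smab': "smooth_on N' (\<lambda>w. \<alpha> (fst w))" "smooth_on N' (\<lambda>w. \<beta> (fst w))"
      by (rule smooth_on_compose[OF op(2) _ lin(3) ab(1)] smooth_on_compose[OF op(2) _ lin(3) ab(2)];
          use bd(2) in \<open>auto simp: N'_def\<close>)+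
    have sm\<Phi>: "smooth_on N \<Phi>"
      unfolding \<Phi>_def Let_def
      by (intro smooth_on_intros smooth_on_divide lin op smX smab) (use \<alpha>_nz in \<open>auto simp: N_def\<close>)
    have sm\<Psi>: "smooth_on N' \<Psi>"
      unfolding \<Psi>_def by (intro smooth_on_intros lin op smab')
    have \<epsilon>2: "\<epsilon> * (\<epsilon> * c) = c" for c
      using \<epsilon>(1) by (metis mult.assoc mult_1)
    have inv1: "\<Psi> (\<Phi> z) = z" if "z \<in> N" for z
      using \<alpha>_nz that by (cases z) (simp add: \<Phi>_def \<Psi>_def N_def Let_def \<epsilon>2)
    have inv2: "\<Phi> (\<Psi> w) = w" if "w \<in> N'" for w
      using \<alpha>_nz that by (cases w) (simp add: \<Phi>_def \<Psi>_def N'_def Let_def \<epsilon>2)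
    have diffeo: "diffeo_on N \<Phi>" "\<Phi> ` N = N'"
      by (rule diffeo_onI[OF op sm\<Phi> sm\<Psi>];
          use inv1 inv2 in \<open>auto simp: \<Phi>_def \<Psi>_def N_def N'_def Let_def \<epsilon>2\<close>)+
    have curve: "\<epsilon> * (fst (\<gamma> (t0 + \<tau>)) - x0) = (s \<tau>)\<^sup>2 \<and>
        (s \<tau> \<in> ball 0 \<eta> \<longrightarrow> \<Phi> (\<gamma> (t0 + \<tau>)) = ((s \<tau>)\<^sup>2, s \<tau> ^ 3))" if \<tau>: "\<tau> \<in> ball 0 r2" for \<tau>
    proof -
      have \<tau>': "\<tau> \<in> ball 0 r1" "\<tau> \<in> ball 0 r" using \<tau> sub by blast+
      have X: "\<epsilon> * (fst (\<gamma> (t0 + \<tau>)) - x0) = (s \<tau>)\<^sup>2"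
        using x[OF \<tau>'(2)] k_sq[OF \<tau>'(1)] by (auto simp: q s_def power_mult_distrib)
      moreover have "\<Phi> (\<gamma> (t0 + \<tau>)) = ((s \<tau>)\<^sup>2, s \<tau> ^ 3)" if st: "s \<tau> \<in> ball 0 \<eta>"
      proof -
        have s1: "s \<tau> \<in> ball 0 \<eta>1" using st \<eta> by auto
        have "(s \<tau>)\<^sup>2 \<in> ball 0 (\<eta>\<^sup>2)"
          using st power_strict_mono[of "\<bar>s \<tau>\<bar>" \<eta> 2] by simp
        then have nz: "\<alpha> ((s \<tau>)\<^sup>2) \<noteq> 0" by (rule \<alpha>_nz)
        have "snd (\<gamma> (t0 + \<tau>)) - y0 - m * (fst (\<gamma> (t0 + \<tau>)) - x0) = \<tau> ^ 3 * g \<tau>"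
          using y[OF \<tau>'(2)] by (simp add: q)
        also have "\<dots> = s \<tau> ^ 3 * h (s \<tau>)"
          using cube[OF s1] T(6)[OF \<tau> s1] by simp
        also have "\<dots> = s \<tau> ^ 3 * \<alpha> ((s \<tau>)\<^sup>2) + ((s \<tau>)\<^sup>2)\<^sup>2 * \<beta> ((s \<tau>)\<^sup>2)"
          by (simp add: ab(3)[OF s1] algebra_simps power2_eq_square power3_eq_cube)
        finally show ?thesis
          using nz by (simp add: \<Phi>_def Let_def X)
      qed
      ultimately show ?thesis by blast
    qed
    have "\<Phi> ` (\<gamma> ` (J \<inter> ball t0 e) \<inter> N) = {(X, Y). Y\<^sup>2 = X ^ 3} \<inter> N'"
    proof (intro subset_antisym subsetI)
      fix w assume "w \<in> \<Phi> ` (\<gamma> ` (J \<inter> ball t0 e) \<inter> N)"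
      then obtain t where t: "t \<in> ball t0 e" "\<gamma> t \<in> N" "w = \<Phi> (\<gamma> t)" by auto
      have \<tau>: "t - t0 \<in> ball 0 r2" using t(1) e by (auto simp: dist_real_def)
      have "(s (t - t0))\<^sup>2 < \<eta>\<^sup>2" using curve[OF \<tau>] t(2) by (simp add: N_def)
      then have "s (t - t0) \<in> ball 0 \<eta>" using \<eta>(1) power2_less_imp_less[of "\<bar>s (t - t0)\<bar>" \<eta>] by simp
      then have "w = ((s (t - t0))\<^sup>2, s (t - t0) ^ 3)" using curve[OF \<tau>] t(3) by simp
      then show "w \<in> {(X, Y). Y\<^sup>2 = X ^ 3} \<inter> N'"
        using \<open>(s (t - t0))\<^sup>2 < \<eta>\<^sup>2\<close> by (simp add: N'_def flip: power_mult)
    next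
      fix w assume "w \<in> {(X, Y). Y\<^sup>2 = X ^ 3} \<inter> N'"
      then obtain X Y where w: "w = (X, Y)" "Y\<^sup>2 = X ^ 3" "\<bar>X\<bar> < \<eta>\<^sup>2" by (auto simp: N'_def)
      have X0: "X \<ge> 0" using w(2) by (metis zero_le_power2 odd_numeral zero_le_odd_power)
      \<comment> \<open>The value of the parameter \<open>s\<close> at the point \<open>(X, Y)\<close> of the model curve.\<close>
      define y where "y = root 3 Y"
      have y3: "y ^ 3 = Y" by (simp add: y_def odd_real_root_pow)
      have "(y\<^sup>2) ^ 3 = X ^ 3" using w(2) y3 by (metis power_mult mult.commute)
      then have y2: "y\<^sup>2 = X" using X0 by (metis power_eq_imp_eq_base zero_le_power2 zero_less_numeral)
      have yb: "y \<in> ball 0 \<eta>"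
        using w(3) y2 \<eta>(1) power2_less_imp_less[of "\<bar>y\<bar>" \<eta>] by simp
      then have Ty: "T y \<in> ball 0 e" "T y \<in> ball 0 r2" "s (T y) = y"
        using \<eta> T(4,5) by blast+
      have "\<Phi> (\<gamma> (t0 + T y)) = w" "\<gamma> (t0 + T y) \<in> N"
        using curve[OF Ty(2)] yb w y2 y3 by (auto simp: Ty(3) N_def)
      moreover have "t0 + T y \<in> J \<inter> ball t0 e" using Ty(1) e(3) by (auto simp: dist_real_def)
      ultimately show "w \<in> \<Phi> ` (\<gamma> ` (J \<inter> ball t0 e) \<inter> N)" by blast
    qed
    moreover have "\<gamma> t0 \<in> N" "\<Phi> (\<gamma> t0) = (0, 0)"
      using \<eta>(1) by (auto simp: q N_def \<Phi>_def)
    ultimately show ?thesis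
      unfolding semicubic_cusp_def using diffeo by (intro exI[of _ N] exI[of _ \<Phi>]) simp
  qed
  obtain e0 where "e0 > 0" "ball t0 e0 \<subseteq> J" using J open_contains_ball by blast
  then have "\<forall>\<^sub>F e in at_right 0. e \<in> {0<..<min e0 r2}"
    using r2(1) by (intro eventually_at_right_real) auto
  then show ?thesis
    unfolding semicubic_at_def
  proof eventually_elim
    case (elim e)
    then show ?case using \<open>ball t0 e0 \<subseteq> J\<close> by (intro cusp) auto
  qed
qed


section \<open>The geodesic vector field\<close>

lemma partial_derivatives:
  fixes f :: "real \<times> real \<Rightarrow> real"
  assumes "(f has_derivative D) (at (x, y))"
  shows "((\<lambda>s. f (s, y)) has_real_derivative D (1, 0)) (at x)"
    and "((\<lambda>s. f (x, s)) has_real_derivative D (0, 1)) (at y)"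
proof -
  have "((\<lambda>s. f (s, y)) has_vector_derivative D (1, 0)) (at x)"
    using assms by (intro vector_derivative_diff_chain_within[where f = "\<lambda>s. (s, y)" and g = f, unfolded o_def])
      (auto intro!: derivative_eq_intros has_derivative_at_withinI)
  then show "((\<lambda>s. f (s, y)) has_real_derivative D (1, 0)) (at x)"
    by (simp add: has_real_derivative_iff_has_vector_derivative)
  have "((\<lambda>s. f (x, s)) has_vector_derivative D (0, 1)) (at y)"
    using assms by (intro vector_derivative_diff_chain_within[where f = "\<lambda>s. (x, s)" and g = f, unfolded o_def])
      (auto intro!: derivative_eq_intros has_derivative_at_withinI)
  then show "((\<lambda>s. f (x, s)) has_real_derivative D (0, 1)) (at y)"
    by (simp add: has_real_derivative_iff_has_vector_derivative)
qed

text \<open>The partial derivatives in the definition of the field are polynomials in \<open>p\<close> whose coefficients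
  are the \<open>a i\<close> and their first partial derivatives.\<close>

lemma smooth_on_V_field:
  assumes U: "open U" and a: "\<forall>i\<le>3. smooth_on U (a i)"
  shows "smooth_on (U \<times> UNIV) (V_field a)"
proof -
  define ax where "ax i z = frechet_derivative (a i) (at z) (1, 0)" for i z
  define ay where "ay i z = frechet_derivative (a i) (at z) (0, 1)" for i z
  have sm: "smooth_on U (ax i)" "smooth_on U (ay i)" if "i \<le> 3" for i
    using smooth_on_frechet_derivative a that unfolding ax_def ay_def by blast+
  have Fx: "F_x a x y p = (\<Sum>i\<le>3. ax i (x, y) * p ^ i)"
    and Fy: "F_y a x y p = (\<Sum>i\<le>3. ay i (x, y) * p ^ i)" if "(x, y) \<in> U" for x y p
  proof -
    have D: "(a i has_derivative frechet_derivative (a i) (at (x, y))) (at (x, y))" if "i \<le> 3" for i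
      using smooth_on_imp_has_derivative a that \<open>(x, y) \<in> U\<close> by blast
    show "F_x a x y p = (\<Sum>i\<le>3. ax i (x, y) * p ^ i)"
      unfolding F_x_def cubic_poly_def ax_def
      by (intro DERIV_imp_deriv DERIV_sum DERIV_cmult_right partial_derivatives D) simp
    show "F_y a x y p = (\<Sum>i\<le>3. ay i (x, y) * p ^ i)"
      unfolding F_y_def cubic_poly_def ay_def
      by (intro DERIV_imp_deriv DERIV_sum DERIV_cmult_right partial_derivatives D) simp
  qed
  have dpoly: "deriv (\<lambda>s. \<Sum>i\<le>3. c i * s ^ i) p = (\<Sum>i\<le>3. c i * (real i * p ^ (i - 1)))"
    for c :: "nat \<Rightarrow> real" and p
    by (rule DERIV_imp_deriv) (auto intro!: derivative_eq_intros sum.cong)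
  have Fp: "F_p a x y p = (\<Sum>i\<le>3. a i (x, y) * (real i * p ^ (i - 1)))" for x y p
    unfolding F_p_def cubic_poly_def by (rule dpoly)
  have Fpp: "F_pp a x y p = (\<Sum>i\<le>3. a i (x, y) * (real i * (real (i - 1) * p ^ (i - 1 - 1))))" for x y p
    unfolding F_pp_def Fp by (rule DERIV_imp_deriv) (auto intro!: derivative_eq_intros sum.cong)
  have Fxp: "F_xp a x y p = (\<Sum>i\<le>3. ax i (x, y) * (real i * p ^ (i - 1)))"
    and Fyp: "F_yp a x y p = (\<Sum>i\<le>3. ay i (x, y) * (real i * p ^ (i - 1)))" if "(x, y) \<in> U" for x y p
    unfolding F_xp_def F_yp_def Fx[OF that] Fy[OF that] by (rule dpoly)+
  define W where "W = U \<times> (UNIV :: real set)"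
  have W: "open W" using U by (simp add: W_def open_Times)
  have sp: "smooth_on W snd" and sz: "smooth_on W fst"
    using W by (auto intro: smooth_on_bounded_linear bounded_linear_snd bounded_linear_fst)
  have "\<And>f. smooth_on U f \<Longrightarrow> smooth_on W (\<lambda>w. f (fst w))"
    by (rule smooth_on_compose[OF W U sz]) (auto simp: W_def)
  then have sm': "smooth_on W (\<lambda>w. a i (fst w))" "smooth_on W (\<lambda>w. ax i (fst w))"
    "smooth_on W (\<lambda>w. ay i (fst w))" if "i \<le> 3" for i
    using a sm that by auto
  define c where "c b w = (\<Sum>i\<le>(3::nat). b i (fst w) * snd w ^ i)"
    for b :: coeffs and w :: "(real \<times> real) \<times> real"
  define d where "d b w = (\<Sum>i\<le>(3::nat). b i (fst w) * (real i * snd w ^ (i - 1)))"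
    for b :: coeffs and w :: "(real \<times> real) \<times> real"
  define d2 where "d2 b w = (\<Sum>i\<le>(3::nat). b i (fst w) * (real i * (real (i - 1) * snd w ^ (i - 1 - 1))))"
    for b :: coeffs and w :: "(real \<times> real) \<times> real"
  have cd: "smooth_on W (c b)" "smooth_on W (d b)" "smooth_on W (d2 b)"
    if b: "\<And>i. i \<le> 3 \<Longrightarrow> smooth_on W (\<lambda>w. b i (fst w))" for b
    unfolding c_def d_def d2_def
    by (intro smooth_on_sum smooth_on_mult smooth_on_power smooth_on_const W sp b; simp)+
  define D where "D = (\<lambda>w. 3 * c a w * d2 a w - 2 * (d a w)\<^sup>2)"
  define Q where "Q = (\<lambda>w. 3 * c a w * (c ay w - d ax w - snd w * d ay w)
    + 2 * d a w * (c ax w + snd w * c ay w))"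
  have "smooth_on W D" "smooth_on W Q"
    unfolding D_def Q_def by (intro smooth_on_intros cd sm' sp W; assumption)+
  then have sm: "smooth_on W (\<lambda>w. ((D w, snd w * D w), Q w))"
    by (intro smooth_on_intros sp W)
  have eq: "((D w, snd w * D w), Q w) = V_field a w" if "w \<in> W" for w
  proof -
    obtain x y p where w: "w = ((x, y), p)" by (metis surj_pair)
    have U: "(x, y) \<in> U" using that by (simp add: w W_def)
    show ?thesis
      unfolding w V_field_def case_prod_conv Delta_def P_fun_def Fx[OF U] Fy[OF U] Fp Fpp Fxp[OF U] Fyp[OF U]
        cubic_poly_def D_def Q_def c_def d_def d2_def fst_conv snd_conv ..
  qed
  have "smooth_on W (V_field a)"
    by (rule smooth_on_cong[OF W eq sm])
  then show ?thesis by (simp only: W_def)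
qed

lemma V_curve_components:
  assumes "integral_curve W (V_field a) J \<sigma>" "t \<in> J" "\<sigma> t = ((x, y), p)"
  shows "((\<lambda>t. fst (fst (\<sigma> t))) has_real_derivative Delta a x y p) (at t)"
    "((\<lambda>t. snd (fst (\<sigma> t))) has_real_derivative p * Delta a x y p) (at t)"
    "((\<lambda>t. snd (\<sigma> t)) has_real_derivative P_fun a x y p) (at t)"
    "((\<lambda>t. fst (\<sigma> t)) has_vector_derivative (Delta a x y p, p * Delta a x y p)) (at t)"
proof -
  have D: "(\<sigma> has_vector_derivative ((Delta a x y p, p * Delta a x y p), P_fun a x y p)) (at t)"
    using assms unfolding integral_curve_def V_field_def by fastforce
  show F: "((\<lambda>t. fst (\<sigma> t)) has_vector_derivative (Delta a x y p, p * Delta a x y p)) (at t)"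
    using bounded_linear.has_vector_derivative[OF bounded_linear_fst D] by simp
  show "((\<lambda>t. snd (\<sigma> t)) has_real_derivative P_fun a x y p) (at t)"
    using bounded_linear.has_vector_derivative[OF bounded_linear_snd D]
    by (simp add: has_real_derivative_iff_has_vector_derivative)
  show "((\<lambda>t. fst (fst (\<sigma> t))) has_real_derivative Delta a x y p) (at t)"
    using bounded_linear.has_vector_derivative[OF bounded_linear_fst F]
    by (simp add: has_real_derivative_iff_has_vector_derivative)
  show "((\<lambda>t. snd (fst (\<sigma> t))) has_real_derivative p * Delta a x y p) (at t)"
    using bounded_linear.has_vector_derivative[OF bounded_linear_snd F]
    by (simp add: has_real_derivative_iff_has_vector_derivative)
qed

lemma V_curve_exists:
  assumes "open U" "\<forall>i\<le>3. smooth_on U (a i)" "q \<in> U"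
  obtains J \<sigma> where "0 \<in> J" "integral_curve (U \<times> UNIV) (V_field a) J \<sigma>" "\<sigma> 0 = (q, p)"
  by (rule integral_curve_exists[of "U \<times> (UNIV :: real set)" "V_field a" "(q, p)"])
    (use assms smooth_on_V_field[OF assms(1,2)] in
      \<open>auto simp: smooth_on_def open_Times simp del: Ck_on.simps\<close>)

text \<open>At a zero of \<open>\<Delta>\<close> the velocity of the lifted curve is vertical, so the coefficients of the metric are
  stationary along it and the derivative of \<open>\<Delta>\<close> is \<open>\<Delta>\<^sub>p * P \<noteq> 0\<close>: both \<open>\<Delta>\<close> and \<open>p - p\<^sub>0\<close> have
  simple zeros.  Integrating \<open>x' = \<Delta>\<close> and \<open>(y - p\<^sub>0 * x)' = (p - p\<^sub>0) * \<Delta>\<close> gives zeros of exact orders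
  two and three.\<close>

lemma cusp_expansion:
  assumes U: "open U" and a: "\<forall>i\<le>3. smooth_on U (a i)" and a3: "\<forall>z\<in>U. a 3 z = 0"
    and \<sigma>: "integral_curve (U \<times> UNIV) (V_field a) J \<sigma>" "t0 \<in> J" "\<sigma> t0 = ((x0, y0), p0)"
    and \<Delta>: "Delta a x0 y0 p0 = 0" "a 2 (x0, y0) * (a 2 (x0, y0) * p0 + a 1 (x0, y0) / 2) \<noteq> 0"
    and P: "P_fun a x0 y0 p0 \<noteq> 0"
  obtains r f g where "r > 0" "\<And>\<tau>. \<tau> \<in> ball 0 r \<Longrightarrow> t0 + \<tau> \<in> J" "smooth_on (ball 0 r) f" "f 0 \<noteq> 0"
    "smooth_on (ball 0 r) g" "g 0 \<noteq> 0"
    "\<And>\<tau>. \<tau> \<in> ball 0 r \<Longrightarrow> fst (fst (\<sigma> (t0 + \<tau>))) - x0 = \<tau> ^ 2 * f \<tau>"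
    "\<And>\<tau>. \<tau> \<in> ball 0 r \<Longrightarrow> snd (fst (\<sigma> (t0 + \<tau>))) - y0
      - p0 * (fst (fst (\<sigma> (t0 + \<tau>))) - x0) = \<tau> ^ 3 * g \<tau>"
proof -
  have "open J" using \<sigma>(1) by (simp add: integral_curve_def)
  then obtain r where r: "r > 0" "ball t0 r \<subseteq> J" using \<sigma>(2) open_contains_ball by blast
  have in_J: "t0 + \<tau> \<in> J" if "\<tau> \<in> ball 0 r" for \<tau>
    using subsetD[OF r(2), of "t0 + \<tau>"] that by (simp add: dist_real_def)
  define \<rho> where "\<rho> = (\<lambda>\<tau>. \<sigma> (t0 + \<tau>))"
  define J' where "J' = {\<tau>. t0 + \<tau> \<in> J}"
  define W where "W = U \<times> (UNIV :: real set)"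
  have W: "open W" using U by (simp add: W_def open_Times)
  have smV: "smooth_on W (V_field a)" unfolding W_def by (rule smooth_on_V_field[OF U a])
  have \<rho>: "integral_curve W (V_field a) J' \<rho>"
    unfolding \<rho>_def J'_def W_def by (rule integral_curve_shift[OF \<sigma>(1)])
  have sub: "ball 0 r \<subseteq> J'" using in_J by (auto simp: J'_def)
  have \<rho>_W: "\<rho> ` ball 0 r \<subseteq> W" using \<rho> sub unfolding integral_curve_def by blast
  have sm\<rho>: "smooth_on (ball 0 r) \<rho>"
    by (rule smooth_on_subset[OF integral_curve_smooth[OF W smV \<rho>] sub])
  have \<rho>0: "\<rho> 0 = ((x0, y0), p0)" by (simp add: \<rho>_def \<sigma>)
  define X where "X = (\<lambda>\<tau>. fst (fst (\<rho> \<tau>)))"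
  define Y where "Y = (\<lambda>\<tau>. snd (fst (\<rho> \<tau>)))"
  define p where "p = (\<lambda>\<tau>. snd (\<rho> \<tau>))"
  define D where "D = (\<lambda>\<tau>. Delta a (X \<tau>) (Y \<tau>) (p \<tau>))"
  define Q where "Q = (\<lambda>\<tau>. P_fun a (X \<tau>) (Y \<tau>) (p \<tau>))"
  have zero: "X 0 = x0" "Y 0 = y0" "p 0 = p0" "D 0 = 0" "Q 0 \<noteq> 0"
    using \<Delta> P by (auto simp: X_def Y_def p_def D_def Q_def \<rho>0)
  have V: "V_field a (\<rho> \<tau>) = ((D \<tau>, p \<tau> * D \<tau>), Q \<tau>)" for \<tau>
    by (simp add: V_field_def D_def Q_def X_def Y_def p_def case_prod_beta)
  have smV': "smooth_on (ball 0 r) (\<lambda>\<tau>. V_field a (\<rho> \<tau>))"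
    by (rule smooth_on_compose[OF open_ball W sm\<rho> smV \<rho>_W])
  have smD: "smooth_on (ball 0 r) D"
    using smooth_on_bounded_linear_compose[OF open_ball bounded_linear_fst
        smooth_on_bounded_linear_compose[OF open_ball bounded_linear_fst smV']] by (simp add: V)
  have smQ: "smooth_on (ball 0 r) Q"
    using smooth_on_bounded_linear_compose[OF open_ball bounded_linear_snd smV'] by (simp add: V)
  have derivs: "(X has_real_derivative D \<tau>) (at \<tau>)" "(Y has_real_derivative p \<tau> * D \<tau>) (at \<tau>)"
    "(p has_real_derivative Q \<tau>) (at \<tau>)"
    "((\<lambda>\<tau>. (X \<tau>, Y \<tau>)) has_vector_derivative (D \<tau>, p \<tau> * D \<tau>)) (at \<tau>)"
    if "\<tau> \<in> ball 0 r" for \<tau>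
  proof -
    have "\<tau> \<in> J'" "\<rho> \<tau> = ((X \<tau>, Y \<tau>), p \<tau>)" using that sub by (auto simp: X_def Y_def p_def)
    from V_curve_components[OF \<rho> this]
    show "(X has_real_derivative D \<tau>) (at \<tau>)" "(Y has_real_derivative p \<tau> * D \<tau>) (at \<tau>)"
      "(p has_real_derivative Q \<tau>) (at \<tau>)"
      "((\<lambda>\<tau>. (X \<tau>, Y \<tau>)) has_vector_derivative (D \<tau>, p \<tau> * D \<tau>)) (at \<tau>)"
      by (simp_all add: X_def Y_def p_def D_def Q_def)
  qed
  obtain D' where D': "smooth_on (ball 0 r) D'"
    "\<And>\<tau>. \<tau> \<in> ball 0 r \<Longrightarrow> (D has_real_derivative D' \<tau>) (at \<tau>)"
    using smooth_on_realE[OF smD] by blast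
  have D'_eq: "D' 0 = - 4 * (a 2 (x0, y0) * (a 2 (x0, y0) * p0 + a 1 (x0, y0) / 2)) * Q 0"
  proof -
    have const: "((\<lambda>\<tau>. a i (X \<tau>, Y \<tau>)) has_real_derivative 0) (at 0)" if "i \<le> 3" for i
    proof -
      have "\<rho> 0 \<in> W" using \<rho>_W r(1) by auto
      then have "(x0, y0) \<in> U" by (simp add: \<rho>0 W_def)
      then have d: "(a i has_derivative frechet_derivative (a i) (at (x0, y0))) (at (X 0, Y 0))"
        using smooth_on_imp_has_derivative[of U "a i"] a that by (simp add: zero)
      have "((\<lambda>\<tau>. (X \<tau>, Y \<tau>)) has_vector_derivative 0) (at 0)"
        using derivs(4)[of 0] r(1) by (simp add: zero zero_prod_def)
      then have "((\<lambda>\<tau>. a i (X \<tau>, Y \<tau>)) has_vector_derivative frechet_derivative (a i) (at (x0, y0)) 0) (at 0)"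
        by (rule vector_derivative_diff_chain_within[where g = "a i", unfolded o_def])
          (rule has_derivative_at_withinI[OF d])
      then show ?thesis
        using linear_0[OF has_derivative_linear[OF d]]
        by (simp add: has_real_derivative_iff_has_vector_derivative)
    qed
    define A B C where "A = (\<lambda>\<tau>. a 2 (X \<tau>, Y \<tau>))" "B = (\<lambda>\<tau>. a 1 (X \<tau>, Y \<tau>) / 2)"
      "C = (\<lambda>\<tau>. a 0 (X \<tau>, Y \<tau>))"
    note abc = this
    have dA: "(A has_real_derivative 0) (at 0)" "(B has_real_derivative 0) (at 0)"
      "(C has_real_derivative 0) (at 0)"
      unfolding abc using const[of 2] const[of 0] DERIV_cdivide[OF const[of 1], of 2] by auto
    have dp: "(p has_real_derivative Q 0) (at 0)" using derivs(3) r(1) by simp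
    have "((\<lambda>\<tau>. - 2 * (A \<tau> * p \<tau> + B \<tau>)\<^sup>2 + 6 * (A \<tau> * C \<tau> - (B \<tau>)\<^sup>2)) has_real_derivative
      - 4 * (A 0 * p 0 + B 0) * A 0 * Q 0) (at 0)"
      by (auto intro!: derivative_eq_intros dA dp simp: algebra_simps)
    then have "(D has_real_derivative - 4 * (A 0 * p 0 + B 0) * A 0 * Q 0) (at 0)"
    proof (rule has_field_derivative_transform_within_open[OF _ open_ball])
      fix \<tau> assume \<tau>: "\<tau> \<in> ball (0::real) r"
      have "\<rho> \<tau> \<in> W" using \<rho>_W \<tau> by blast
      then have "(X \<tau>, Y \<tau>) \<in> U" by (auto simp: W_def X_def Y_def mem_Times_iff)
      then show "- 2 * (A \<tau> * p \<tau> + B \<tau>)\<^sup>2 + 6 * (A \<tau> * C \<tau> - (B \<tau>)\<^sup>2) = D \<tau>"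
        unfolding D_def by (intro Delta_adapted[symmetric]) (auto simp: abc a3)
    qed (use r in auto)
    moreover have "(D has_real_derivative D' 0) (at 0)" using D'(2) r(1) by simp
    ultimately have "D' 0 = - 4 * (A 0 * p 0 + B 0) * A 0 * Q 0" using DERIV_unique by blast
    then show ?thesis by (simp only: abc zero mult_ac)
  qed
  have D'0: "D' 0 \<noteq> 0"
    unfolding D'_eq by (rule no_zero_divisors[OF no_zero_divisors[OF _ \<Delta>(2)] zero(5)]) simp
  obtain d where d: "smooth_on (ball 0 r) d" "\<And>\<tau>. \<tau> \<in> ball 0 r \<Longrightarrow> D \<tau> = \<tau> * d \<tau>" "d 0 = D' 0"
  proof (rule Hadamard_factor[OF r(1) D'(1), where u = D and n = 0])
    show "(D has_real_derivative \<tau> ^ 0 * D' \<tau>) (at \<tau>)" if "\<tau> \<in> ball 0 r" for \<tau>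
      using D'(2)[OF that] by simp
  qed (auto simp: zero)
  obtain e where e: "smooth_on (ball 0 r) e" "\<And>\<tau>. \<tau> \<in> ball 0 r \<Longrightarrow> p \<tau> - p0 = \<tau> * e \<tau>" "e 0 = Q 0"
  proof (rule Hadamard_factor[OF r(1) smQ, where u = "\<lambda>\<tau>. p \<tau> - p0" and n = 0])
    show "((\<lambda>\<tau>. p \<tau> - p0) has_real_derivative \<tau> ^ 0 * Q \<tau>) (at \<tau>)" if "\<tau> \<in> ball 0 r" for \<tau>
      using derivs(3)[OF that] by (auto intro!: derivative_eq_intros)
  qed (auto simp: zero)
  obtain f where f: "smooth_on (ball 0 r) f" "\<And>\<tau>. \<tau> \<in> ball 0 r \<Longrightarrow> X \<tau> - x0 = \<tau> ^ 2 * f \<tau>" "f 0 = d 0 / 2"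
  proof (rule Hadamard_factor[OF r(1) d(1), where u = "\<lambda>\<tau>. X \<tau> - x0" and n = 1])
    show "((\<lambda>\<tau>. X \<tau> - x0) has_real_derivative \<tau> ^ 1 * d \<tau>) (at \<tau>)" if "\<tau> \<in> ball 0 r" for \<tau>
      using derivs(1)[OF that] d(2)[OF that] by (auto intro!: derivative_eq_intros)
  qed (auto simp: zero numeral_2_eq_2)
  have "smooth_on (ball 0 r) (\<lambda>\<tau>. e \<tau> * d \<tau>)" by (intro smooth_on_mult e d open_ball)
  then obtain g where g: "smooth_on (ball 0 r) g" "g 0 = e 0 * d 0 / 3"
    "\<And>\<tau>. \<tau> \<in> ball 0 r \<Longrightarrow> Y \<tau> - y0 - p0 * (X \<tau> - x0) = \<tau> ^ 3 * g \<tau>"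
  proof (rule Hadamard_factor[OF r(1), where u = "\<lambda>\<tau>. Y \<tau> - y0 - p0 * (X \<tau> - x0)" and n = 2])
    fix \<tau> :: real assume \<tau>: "\<tau> \<in> ball 0 r"
    have "((\<lambda>\<tau>. Y \<tau> - y0 - p0 * (X \<tau> - x0)) has_real_derivative (p \<tau> - p0) * D \<tau>) (at \<tau>)"
      using derivs(1,2)[OF \<tau>] by (auto intro!: derivative_eq_intros simp: algebra_simps)
    then show "((\<lambda>\<tau>. Y \<tau> - y0 - p0 * (X \<tau> - x0)) has_real_derivative \<tau> ^ 2 * (e \<tau> * d \<tau>)) (at \<tau>)"
      using d(2)[OF \<tau>] e(2)[OF \<tau>] by (simp add: power2_eq_square mult_ac)
  qed (auto simp: zero numeral_3_eq_3)
  show thesis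
    using f g by (intro that[of r f g] r(1) in_J)
      (use D'0 zero in \<open>auto simp: d e X_def Y_def \<rho>_def\<close>)
qed

text \<open>Where \<open>\<Delta> \<noteq> 0\<close> the field is transversal to the fibres, so the projection of the curve is an
  immersion.\<close>

lemma regular_at_of_Delta_nonzero:
  assumes U: "open U" and a: "\<forall>i\<le>3. smooth_on U (a i)"
    and \<sigma>: "integral_curve (U \<times> UNIV) (V_field a) J \<sigma>" "t0 \<in> J" "\<sigma> t0 = ((x0, y0), p0)"
    and \<Delta>: "Delta a x0 y0 p0 \<noteq> 0" and \<gamma>: "\<forall>t\<in>J. \<gamma> t = fst (\<sigma> t)"
  shows "regular_at J t0 \<gamma>" "\<not> \<gamma> constant_on J"
proof -
  define W where "W = U \<times> (UNIV :: real set)"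
  have W: "open W" using U by (simp add: W_def open_Times)
  have smV: "smooth_on W (V_field a)" unfolding W_def by (rule smooth_on_V_field[OF U a])
  have J: "open J" using \<sigma>(1) by (simp add: integral_curve_def)
  have sm\<sigma>: "smooth_on J \<sigma>" by (rule integral_curve_smooth[OF W smV \<sigma>(1)[folded W_def]])
  have \<sigma>W: "\<sigma> ` J \<subseteq> W" using \<sigma>(1) unfolding integral_curve_def W_def by blast
  define D where "D t = fst (fst (V_field a (\<sigma> t)))" for t
  have Dc: "continuous_on J D"
    unfolding D_def
    by (intro continuous_intros continuous_on_compose2[OF smooth_on_imp_continuous_on[OF smV]
          smooth_on_imp_continuous_on[OF sm\<sigma>] \<sigma>W])
  have vd: "(\<gamma> has_vector_derivative (D t, snd (\<sigma> t) * D t)) (at t)" if "t \<in> J" for t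
  proof (rule has_vector_derivative_transform_within_open[OF _ J that])
    show "((\<lambda>t. fst (\<sigma> t)) has_vector_derivative (D t, snd (\<sigma> t) * D t)) (at t)"
      using V_curve_components(4)[OF \<sigma>(1) that, of "fst (fst (\<sigma> t))" "snd (fst (\<sigma> t))" "snd (\<sigma> t)"]
      by (simp add: D_def V_field_def case_prod_beta)
  qed (use \<gamma> in auto)
  have D0: "D t0 \<noteq> 0" using \<Delta> by (simp add: D_def \<sigma>(3) V_field_def)
  have "open (J \<inter> D -` (- {0}))" by (rule continuous_open_preimage[OF Dc J]) auto
  then obtain e where e: "e > 0" "ball t0 e \<subseteq> J \<inter> D -` (- {0})"
    using D0 \<sigma>(2) open_contains_ball by (metis ComplI IntI singletonD vimageI2)
  have "smooth_on (ball t0 e) \<gamma>"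
  proof (rule smooth_on_cong[OF open_ball])
    show "smooth_on (ball t0 e) (\<lambda>t. fst (\<sigma> t))"
      using e(2) by (intro smooth_on_bounded_linear_compose[OF open_ball bounded_linear_fst]
          smooth_on_subset[OF sm\<sigma>]) auto
  qed (use \<gamma> e in auto)
  moreover have "vector_derivative \<gamma> (at t) \<noteq> 0" if "t \<in> ball t0 e" for t
  proof -
    have "t \<in> J" "D t \<noteq> 0" using e(2) that by blast+
    then show ?thesis using vector_derivative_at[OF vd] by (simp add: zero_prod_def)
  qed
  ultimately show "regular_at J t0 \<gamma>"
    unfolding regular_at_def using e by (intro exI[of _ e]) auto
  show "\<not> \<gamma> constant_on J"
  proof
    assume "\<gamma> constant_on J"
    then obtain c where "\<forall>t\<in>J. \<gamma> t = c" unfolding constant_on_def by blast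
    then have "(\<gamma> has_vector_derivative 0) (at t0)"
      by (intro has_vector_derivative_transform_within_open[OF has_vector_derivative_const J \<sigma>(2)]) auto
    then show False
      using vector_derivative_at[OF vd[OF \<sigma>(2)]] D0
      by (simp add: vector_derivative_at zero_prod_def)
  qed
qed

lemma regular_at_swap:
  assumes "regular_at J t0 (prod.swap \<circ> \<gamma>)"
  shows "regular_at J t0 \<gamma>"
proof -
  obtain e where e: "e > 0" "ball t0 e \<subseteq> J" "smooth_on (ball t0 e) (prod.swap \<circ> \<gamma>)"
    "\<And>t. t \<in> ball t0 e \<Longrightarrow> vector_derivative (prod.swap \<circ> \<gamma>) (at t) \<noteq> 0"
    using assms unfolding regular_at_def by blast
  have bl: "bounded_linear (prod.swap :: real \<times> real \<Rightarrow> _)"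
    unfolding prod.swap_def by (intro bounded_linear_intros)
  have "smooth_on (ball t0 e) \<gamma>"
    using smooth_on_bounded_linear_compose[OF open_ball bl e(3)] by simp
  moreover have "vector_derivative \<gamma> (at t) \<noteq> 0" if "t \<in> ball t0 e" for t
  proof
    assume 0: "vector_derivative \<gamma> (at t) = 0"
    have "\<gamma> differentiable (at t)"
      using smooth_on_imp_has_derivative[OF calculation that] by (auto simp: differentiable_def)
    then have "(\<gamma> has_vector_derivative 0) (at t)"
      using 0 by (metis vector_derivative_works)
    from bounded_linear.has_vector_derivative[OF bl this]
    have "((prod.swap \<circ> \<gamma>) has_vector_derivative 0) (at t)"
      by (simp add: o_def zero_prod_def)
    then show False using e(4)[OF that] vector_derivative_at by blast
  qed
  ultimately show ?thesis unfolding regular_at_def using e by blast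
qed


section \<open>Geodesics through a point\<close>

text \<open>The point and the direction determine the initial value of the lifted curve.\<close>

lemma affine_geodesic_unique:
  assumes U: "open U" and a: "\<forall>i\<le>3. smooth_on U (a i)"
    and "affine_geodesic U a J1 t1 \<gamma>1 q p" "affine_geodesic U a J2 t2 \<gamma>2 q p"
    and s: "t1 + s \<in> J1" "t2 + s \<in> J2"
  shows "\<gamma>1 (t1 + s) = \<gamma>2 (t2 + s)"
proof -
  let ?W = "U \<times> (UNIV :: real set)"
  obtain \<sigma>1 where 1: "t1 \<in> J1" "integral_curve ?W (V_field a) J1 \<sigma>1" "\<sigma>1 t1 = (q, p)"
    "\<forall>t\<in>J1. \<gamma>1 t = fst (\<sigma>1 t)" using assms(3) unfolding affine_geodesic_def by blast
  obtain \<sigma>2 where 2: "t2 \<in> J2" "integral_curve ?W (V_field a) J2 \<sigma>2" "\<sigma>2 t2 = (q, p)"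
    "\<forall>t\<in>J2. \<gamma>2 t = fst (\<sigma>2 t)" using assms(4) unfolding affine_geodesic_def by blast
  define J where "J = {s. t1 + s \<in> J1} \<inter> {s. t2 + s \<in> J2}"
  note c = integral_curve_shift[OF 1(2), of t1] integral_curve_shift[OF 2(2), of t2]
  have J: "open J" "is_interval J"
    using c unfolding J_def integral_curve_def by (auto intro: is_interval_Int)
  have c1: "integral_curve ?W (V_field a) J (\<lambda>s. \<sigma>1 (t1 + s))"
    using c(1) J unfolding integral_curve_def by (auto simp: J_def)
  have c2: "integral_curve ?W (V_field a) J (\<lambda>s. \<sigma>2 (t2 + s))"
    using c(2) J unfolding integral_curve_def by (auto simp: J_def)
  have V: "Ck_on 1 ?W (V_field a)"
    using smooth_on_V_field[OF U a] unfolding smooth_on_def by blast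
  have W: "open ?W" using U by (simp add: open_Times)
  have "\<sigma>1 (t1 + s) = \<sigma>2 (t2 + s)"
    by (rule integral_curve_unique[OF W V c1 c2, of 0]) (use 1(1,3) 2(1,3) s in \<open>auto simp: J_def\<close>)
  then show ?thesis using 1(4) 2(4) s by simp
qed

lemma regular_affine_geodesics:
  assumes U: "open U" and a: "\<forall>i\<le>3. smooth_on U (a i)" and q: "(x, y) \<in> U"
    and \<Delta>: "Delta a x y p \<noteq> 0"
  shows "\<exists>J t0 \<gamma>. affine_geodesic U a J t0 \<gamma> (x, y) p"
    and "affine_geodesic U a J t0 \<gamma> (x, y) p \<Longrightarrow> regular_at J t0 \<gamma>"
proof -
  obtain J \<sigma> where \<sigma>: "0 \<in> J" "integral_curve (U \<times> UNIV) (V_field a) J \<sigma>" "\<sigma> 0 = ((x, y), p)"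
    using V_curve_exists[where a = a and p = p] U a q by blast
  have "\<not> (\<lambda>t. fst (\<sigma> t)) constant_on J"
    by (rule regular_at_of_Delta_nonzero(2)[OF U a \<sigma>(2,1,3) \<Delta>]) simp
  then have "affine_geodesic U a J 0 (\<lambda>t. fst (\<sigma> t)) (x, y) p"
    unfolding affine_geodesic_def using \<sigma> by blast
  then show "\<exists>J t0 \<gamma>. affine_geodesic U a J t0 \<gamma> (x, y) p" by blast
  show "regular_at J t0 \<gamma>" if geo: "affine_geodesic U a J t0 \<gamma> (x, y) p" for J t0 \<gamma>
  proof -
    obtain \<sigma> where "t0 \<in> J" "integral_curve (U \<times> UNIV) (V_field a) J \<sigma>" "\<sigma> t0 = ((x, y), p)"
      "\<forall>t\<in>J. \<gamma> t = fst (\<sigma> t)" using geo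
      unfolding affine_geodesic_def by blast
    then show ?thesis using regular_at_of_Delta_nonzero(1)[OF U a _ _ _ \<Delta>] by blast
  qed
qed

lemma cuspidal_affine_geodesics:
  assumes U: "open U" and a: "\<forall>i\<le>3. smooth_on U (a i)" and a3: "\<forall>z\<in>U. a 3 z = 0"
    and q: "(x, y) \<in> U"
    and \<Delta>: "Delta a x y p = 0" "a 2 (x, y) * (a 2 (x, y) * p + a 1 (x, y) / 2) \<noteq> 0"
    and P: "P_fun a x y p \<noteq> 0"
  shows "\<exists>J t0 \<gamma>. affine_geodesic U a J t0 \<gamma> (x, y) p"
    and "affine_geodesic U a J t0 \<gamma> (x, y) p \<Longrightarrow> semicubic_at J t0 \<gamma>"
proof -
  obtain J \<sigma> where \<sigma>: "0 \<in> J" "integral_curve (U \<times> UNIV) (V_field a) J \<sigma>" "\<sigma> 0 = ((x, y), p)"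
    using V_curve_exists[where a = a and p = p] U a q by blast
  have "\<not> (\<lambda>t. fst (\<sigma> t)) constant_on J"
  proof
    assume "(\<lambda>t. fst (\<sigma> t)) constant_on J"
    then have const: "fst (\<sigma> t) = (x, y)" if "t \<in> J" for t
      using that \<sigma>(1,3) unfolding constant_on_def by (metis fst_conv)
    obtain r f where r: "r > 0" "\<And>\<tau>. \<tau> \<in> ball 0 r \<Longrightarrow> 0 + \<tau> \<in> J" "smooth_on (ball 0 r) f" "f 0 \<noteq> 0"
      "\<And>\<tau>. \<tau> \<in> ball 0 r \<Longrightarrow> fst (fst (\<sigma> (0 + \<tau>))) - x = \<tau> ^ 2 * f \<tau>"
      using cusp_expansion[OF U a a3 \<sigma>(2,1,3) \<Delta> P] by metis
    have f0: "f \<tau> = 0" if "\<tau> \<in> ball 0 r" "\<tau> \<noteq> 0" for \<tau>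
      using r(2)[OF that(1)] r(5)[OF that(1)] that(2) const by simp
    have "isCont f 0"
      using smooth_on_imp_continuous_on[OF r(3)] r(1) by (simp add: continuous_on_eq_continuous_at)
    then have "(f \<longlongrightarrow> f 0) (at 0)" by (simp add: isCont_def)
    moreover have "\<forall>\<^sub>F \<tau> in at 0. f \<tau> = 0"
      unfolding eventually_at using r(1) f0 by (intro exI[of _ r]) (auto simp: dist_real_def)
    then have "(f \<longlongrightarrow> 0) (at 0)" by (rule tendsto_eventually)
    ultimately show False using r(4) tendsto_unique[of "at (0::real)"] by auto
  qed
  then have "affine_geodesic U a J 0 (\<lambda>t. fst (\<sigma> t)) (x, y) p"
    unfolding affine_geodesic_def using \<sigma> by blast
  then show "\<exists>J t0 \<gamma>. affine_geodesic U a J t0 \<gamma> (x, y) p" by blast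
  show "semicubic_at J t0 \<gamma>" if geo: "affine_geodesic U a J t0 \<gamma> (x, y) p" for J t0 \<gamma>
  proof -
    obtain \<sigma> where \<sigma>: "integral_curve (U \<times> UNIV) (V_field a) J \<sigma>" "t0 \<in> J" "\<sigma> t0 = ((x, y), p)"
      and \<gamma>: "\<forall>t\<in>J. \<gamma> t = fst (\<sigma> t)" using geo unfolding affine_geodesic_def by blast
    have J: "open J" using \<sigma>(1) by (simp add: integral_curve_def)
    obtain r f g where r: "r > 0" "\<And>\<tau>. \<tau> \<in> ball 0 r \<Longrightarrow> t0 + \<tau> \<in> J"
      and f: "smooth_on (ball 0 r) f" "f 0 \<noteq> 0" and g: "smooth_on (ball 0 r) g" "g 0 \<noteq> 0"
      and fx: "\<And>\<tau>. \<tau> \<in> ball 0 r \<Longrightarrow> fst (fst (\<sigma> (t0 + \<tau>))) - x = \<tau> ^ 2 * f \<tau>"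
      and gy: "\<And>\<tau>. \<tau> \<in> ball 0 r \<Longrightarrow> snd (fst (\<sigma> (t0 + \<tau>))) - y
        - p * (fst (fst (\<sigma> (t0 + \<tau>))) - x) = \<tau> ^ 3 * g \<tau>"
      using cusp_expansion[OF U a a3 \<sigma> \<Delta> P] by blast
    have \<gamma>0: "\<gamma> t0 = (x, y)" using \<gamma> \<sigma>(2,3) by simp
    have \<gamma>': "\<gamma> (t0 + \<tau>) = fst (\<sigma> (t0 + \<tau>))" if "\<tau> \<in> ball 0 r" for \<tau>
      using \<gamma> r(2)[OF that] by blast
    show ?thesis
    proof (rule semicubic_at_of_factorization[OF J \<sigma>(2) r(1) f g])
      fix \<tau> :: real assume \<tau>: "\<tau> \<in> ball 0 r"
      show "fst (\<gamma> (t0 + \<tau>)) - fst (\<gamma> t0) = \<tau> ^ 2 * f \<tau>"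
        using fx[OF \<tau>] by (simp only: \<gamma>0 \<gamma>'[OF \<tau>] fst_conv)
      show "snd (\<gamma> (t0 + \<tau>)) - snd (\<gamma> t0) - p * (fst (\<gamma> (t0 + \<tau>)) - fst (\<gamma> t0)) = \<tau> ^ 3 * g \<tau>"
        using gy[OF \<tau>] by (simp only: \<gamma>0 \<gamma>'[OF \<tau>] fst_conv snd_conv)
    qed
  qed
qed

lemma M_minus_adaptedD:
  assumes "\<forall>z\<in>U. a 3 z = 0" "q \<in> M_minus U a"
  shows "q \<in> U" "a 2 q \<noteq> 0" "a 2 q * a 0 q - (a 1 q / 2)\<^sup>2 > 0"
proof -
  show "q \<in> U" using assms(2) by (simp add: M_minus_def)
  then show "a 2 q \<noteq> 0" "a 2 q * a 0 q - (a 1 q / 2)\<^sup>2 > 0"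
    using M_minus_adapted(2)[of a q "a 2 q" "a 1 q / 2" "a 0 q" U] assms by auto
qed

text \<open>In adapted coordinates \<open>\<Delta> = 2 * (\<delta>\<^sup>2 - (A * p + B)\<^sup>2)\<close>.\<close>

lemma Delta_eq_0_iff:
  assumes "\<forall>z\<in>U. a 3 z = 0" "(x, y) \<in> M_minus U a"
  shows "Delta a x y p = 0 \<longleftrightarrow> p = p_dir a 1 (x, y) \<or> p = p_dir a 2 (x, y)"
proof -
  define A B C where "A = a 2 (x, y)" "B = a 1 (x, y) / 2" "C = a 0 (x, y)"
  note abc = this
  define \<delta> where "\<delta> = sqrt (3 * (A * C - B\<^sup>2))"
  have A: "A \<noteq> 0" "A * C - B\<^sup>2 > 0" "a 3 (x, y) = 0"
    using M_minus_adaptedD[OF assms] assms(1) by (auto simp: abc)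
  have "\<delta>\<^sup>2 = 3 * (A * C - B\<^sup>2)" using A(2) by (simp add: \<delta>_def)
  then have "Delta a x y p = 2 * (\<delta>\<^sup>2 - (A * p + B)\<^sup>2)"
    using Delta_adapted[of a x y A B C p] A(3) by (simp add: abc)
  then have "Delta a x y p = 0 \<longleftrightarrow> A * p + B = \<delta> \<or> A * p + B = - \<delta>"
    by (auto simp: power2_eq_iff)
  moreover have "A * p + B = \<delta> \<longleftrightarrow> p = p_dir a 1 (x, y)" "A * p + B = - \<delta> \<longleftrightarrow> p = p_dir a 2 (x, y)"
    using A(1) by (auto simp: p_dir_def Let_def \<delta>_def abc field_simps)
  ultimately show ?thesis by simp
qed

lemma p_dir_simple_roots:
  assumes "\<forall>z\<in>U. a 3 z = 0" "q \<in> M_minus U a"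
  shows "p_dir a 1 q \<noteq> p_dir a 2 q"
    and "i \<in> {1, 2} \<Longrightarrow> a 2 q * (a 2 q * p_dir a i q + a 1 q / 2) \<noteq> 0"
  using M_minus_adaptedD[OF assms] by (auto simp: p_dir_def Let_def)

lemma smooth_on_swap_coeffs:
  assumes "open U" "\<forall>i\<le>3. smooth_on U (a i)"
  shows "open (prod.swap ` U)" "\<forall>i\<le>3. smooth_on (prod.swap ` U) (swap_coeffs a i)"
proof -
  have vim: "prod.swap ` U = prod.swap -` U" by (auto intro: image_eqI[where x = "prod.swap z" for z])
  have "continuous_on UNIV (prod.swap :: real \<times> real \<Rightarrow> _)"
    unfolding prod.swap_def by (intro continuous_intros)
  then show op: "open (prod.swap ` U)" unfolding vim by (intro open_vimage assms)
  have bl: "bounded_linear (prod.swap :: real \<times> real \<Rightarrow> _)"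
    unfolding prod.swap_def by (intro bounded_linear_intros)
  show "\<forall>i\<le>3. smooth_on (prod.swap ` U) (swap_coeffs a i)"
    unfolding swap_coeffs_def using assms
    by (auto intro!: smooth_on_compose[OF op _ smooth_on_bounded_linear[OF op bl]])
qed

text \<open>The vertical direction is a simple isotropic one: after the exchange of coordinates
  \<open>F = 0\<close> and \<open>F\<^sub>p = a 2\<close> at \<open>p = 0\<close>, whence \<open>\<Delta> = - 2 * (a 2)\<^sup>2\<close>.\<close>

lemma Delta_swap_coeffs_vertical:
  assumes "a 3 (x, y) = 0" "a 2 (x, y) \<noteq> 0"
  shows "Delta (swap_coeffs a) y x 0 \<noteq> 0"
proof -
  have F: "cubic_poly (swap_coeffs a) y x = (\<lambda>p. a 2 (x, y) * p + a 1 (x, y) * p\<^sup>2 + a 0 (x, y) * p ^ 3)"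
    using assms(1) by (auto simp: cubic_poly_def swap_coeffs_def numeral_3_eq_3 numeral_2_eq_2)
  have "F_p (swap_coeffs a) y x 0 = a 2 (x, y)"
    unfolding F_p_def F by (rule DERIV_imp_deriv) (auto intro!: derivative_eq_intros)
  then show ?thesis using assms(2) by (simp add: Delta_def F)
qed

theorem theorem1:
  fixes U :: "(real \<times> real) set" and a :: coeffs and q :: "real \<times> real"
  assumes "open U"
    and "\<forall>i\<le>3. smooth_on U (a i)"
    and "\<forall>z\<in>U. a 3 z = 0"
    and "q \<in> M_minus U a"
  shows "(\<forall>i\<in>{1, 2}. (q, p_dir a i q) \<notin> S_bar U a i \<longrightarrow>
            unique_geodesic U a q (Slope (p_dir a i q)) \<and>
            (\<forall>J t0 \<gamma>. geodesic U a J t0 \<gamma> q (Slope (p_dir a i q)) \<longrightarrow> semicubic_at J t0 \<gamma>)) \<and>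
         (q \<notin> S_curve U a 1 \<union> S_curve U a 2 \<longrightarrow>
            p_dir a 1 q \<noteq> p_dir a 2 q \<and>
            (\<forall>i\<in>{1, 2}. \<exists>J t0 \<gamma>.
               geodesic U a J t0 \<gamma> q (Slope (p_dir a i q)) \<and> semicubic_at J t0 \<gamma>) \<and>
            (\<forall>d. d \<notin> {Slope (p_dir a 1 q), Slope (p_dir a 2 q)} \<longrightarrow>
               (\<exists>J t0 \<gamma>. geodesic U a J t0 \<gamma> q d) \<and>
               (\<forall>J t0 \<gamma>. geodesic U a J t0 \<gamma> q d \<longrightarrow> regular_at J t0 \<gamma>)))"
proof -
  obtain x y where q: "q = (x, y)" by fastforce
  note qM = assms(4)[unfolded q]
  have qU: "(x, y) \<in> U" and a2: "a 2 (x, y) \<noteq> 0"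
    using M_minus_adaptedD[OF assms(3) qM] by auto
  have cusp: "(\<exists>J t0 \<gamma>. geodesic U a J t0 \<gamma> q (Slope (p_dir a i q))) \<and>
      (\<forall>J t0 \<gamma>. geodesic U a J t0 \<gamma> q (Slope (p_dir a i q)) \<longrightarrow> semicubic_at J t0 \<gamma>)"
    if i: "i \<in> {1, 2}" and "q \<notin> S_curve U a i" for i
  proof -
    have "P_fun a x y (p_dir a i (x, y)) \<noteq> 0"
      using that(2) qM by (auto simp: S_curve_def q)
    moreover have "Delta a x y (p_dir a i (x, y)) = 0"
      using Delta_eq_0_iff[OF assms(3) qM] i by auto
    ultimately show ?thesis
      using cuspidal_affine_geodesics[OF assms(1-3) qU _ p_dir_simple_roots(2)[OF assms(3) qM i]]
      unfolding geodesic_def q by simp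
  qed
  have unique: "unique_geodesic U a q (Slope (p_dir a i q))"
    if "i \<in> {1, 2}" "q \<notin> S_curve U a i" for i
    unfolding unique_geodesic_def
    using cusp[OF that] affine_geodesic_unique[OF assms(1,2)] by (simp add: geodesic_def) blast
  have regular: "(\<exists>J t0 \<gamma>. geodesic U a J t0 \<gamma> q d) \<and>
      (\<forall>J t0 \<gamma>. geodesic U a J t0 \<gamma> q d \<longrightarrow> regular_at J t0 \<gamma>)"
    if d: "d \<notin> {Slope (p_dir a 1 q), Slope (p_dir a 2 q)}" for d
  proof (cases d)
    case (Slope p)
    have "Delta a x y p \<noteq> 0"
      using d Delta_eq_0_iff[OF assms(3) qM] by (auto simp: Slope q)
    from regular_affine_geodesics[OF assms(1,2) qU this] show ?thesis
      by (simp add: geodesic_def Slope q)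
  next
    case Vertical
    note sw = smooth_on_swap_coeffs[OF assms(1,2)]
    have yx: "(y, x) \<in> prod.swap ` U" using qU by force
    have "Delta (swap_coeffs a) y x 0 \<noteq> 0"
      using Delta_swap_coeffs_vertical a2 assms(3) qU by blast
    note reg = regular_affine_geodesics[OF sw yx this]
    from reg(1) obtain J t0 \<gamma> where
      "affine_geodesic (prod.swap ` U) (swap_coeffs a) J t0 \<gamma> (y, x) 0" by blast
    then have "geodesic U a J t0 (prod.swap \<circ> \<gamma>) q d"
      by (simp add: geodesic_def Vertical q o_assoc[symmetric] o_def)
    moreover have "regular_at J t0 \<gamma>" if "geodesic U a J t0 \<gamma> q d" for J t0 \<gamma>
    proof (rule regular_at_swap)
      show "regular_at J t0 (prod.swap \<circ> \<gamma>)"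
        by (rule reg(2)) (use that in \<open>simp add: geodesic_def Vertical q\<close>)
    qed
    ultimately show ?thesis by blast
  qed
  have S_bar: "q \<notin> S_curve U a i" if "(q, p_dir a i q) \<notin> S_bar U a i" for i
    using that by (auto simp: S_bar_def)
  show ?thesis
  proof (intro conjI ballI impI)
    fix i :: nat assume i: "i \<in> {1, 2}" "(q, p_dir a i q) \<notin> S_bar U a i"
    note S = S_bar[OF i(2)]
    show "unique_geodesic U a q (Slope (p_dir a i q))" by (rule unique[OF i(1) S])
    show "\<forall>J t0 \<gamma>. geodesic U a J t0 \<gamma> q (Slope (p_dir a i q)) \<longrightarrow> semicubic_at J t0 \<gamma>"
      using cusp[OF i(1) S] by (rule conjunct2)
  next
    show "p_dir a 1 q \<noteq> p_dir a 2 q" by (rule p_dir_simple_roots(1)[OF assms(3,4)])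
  next
    fix i :: nat assume "q \<notin> S_curve U a 1 \<union> S_curve U a 2" and i: "i \<in> {1, 2}"
    then have "q \<notin> S_curve U a i" by auto
    from cusp[OF i this] show "\<exists>J t0 \<gamma>. geodesic U a J t0 \<gamma> q (Slope (p_dir a i q)) \<and> semicubic_at J t0 \<gamma>"
      by blast
  next
    show "\<forall>d. d \<notin> {Slope (p_dir a 1 q), Slope (p_dir a 2 q)} \<longrightarrow>
               (\<exists>J t0 \<gamma>. geodesic U a J t0 \<gamma> q d) \<and>
               (\<forall>J t0 \<gamma>. geodesic U a J t0 \<gamma> q d \<longrightarrow> regular_at J t0 \<gamma>)"
      using regular by blast
  qed
qed

end
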